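(* Let $f_0=f_0(x,v)\ge0$ be $C^1$ and compactly supported on $\mathbb{R}\times\mathbb{R}^2$, and let $f$ be the corresponding global solution of the monocharged relativistic Vlasov-Poisson system with $f(0,x,v)=f_0(x,v)$, charge density $\rho$, and characteristics $X(s,t,x,v)$, $V(s,t,x,v)=(V_1,V_2)(s,t,x,v)$. Assume there is $F_0\in L^1(\mathbb{R}^2)$ such that $f_0(x,v)\le F_0(v)$ for all $x\in\mathbb{R}$, $v\in\mathbb{R}^2$. Then, for all $x\in\mathbb{R}$ and $v\in\mathbb{R}^2$, $$1\le \frac{\partial V_1}{\partial v_1}(s,t,x,v)\quad\text{for } 0\le s\le t,$$ and $$\rho(t,x)\le\int_{\mathbb{R}^2} F_0(v)\,dv\quad\text{for } t\ge0,\ x\in\mathbb{R}.$$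
   Context: The monocharged ``one and one-half dimensional'' relativistic Vlasov-Poisson system, for the unknown $f=f(t,x,v)\ge 0$ (particle number density), $t\ge 0$, $x\in\mathbb{R}$, $v=(v_1,v_2)\in\mathbb{R}^2$, is $$\partial_t f+\hat v_1\,\partial_x f+E_1\,\partial_{v_1}f=0,\qquad \rho(t,x)=\int_{\mathbb{R}^2} f(t,x,v)\,dv,$$ $$E_1(t,x)=\frac12\left(\int_{-\infty}^x\rho(t,y)\,dy-\int_x^\infty\rho(t,y)\,dy\right),$$ where $\hat v=v/\sqrt{1+|v|^2}$, so $\hat v_1=v_1/\sqrt{1+v_1^2+v_2^2}$. For initial data $f(0,x,v)=f_0(x,v)$ that are $C^1$, nonnegative and compactly supported, it is known that there is a solution that is $C^1$ for all $t\ge0$, with $f(t,\cdot,\cdot)$ compactly supported for each $t\geq 0$; solutions are understood in this sense. The characteristics $X(s)=X(s,t,x,v)$, $V(s)=V(s,t,x,v)$ are defined by $$\frac{dX}{ds}=\widehat{V}_1(s)=\frac{V_1(s)}{\sqrt{1+|V(s)|^2}},\qquad \frac{dV_1}{ds}=E_1(s,X(s)),\qquad V_2(s,t,x,v)=v_2,$$ with $X(t,t,x,v)=x$ and $V_1(t,t,x,v)=v_1$. *)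

theory Defs
  imports "HOL-Analysis.Analysis"
begin

text \<open>
  A particle has position \<open>x :: real\<close> and momentum \<open>v :: real \<times> real\<close>, so that \<open>norm v\<close> is
  the Euclidean norm. Time ranges over the closed half line; the values of \<open>f\<close> at
  negative times are irrelevant, and time derivatives at time 0 are one-sided.
\<close>

definition C1_on :: "('a::real_normed_vector \<Rightarrow> 'b::real_normed_vector) \<Rightarrow> 'a set \<Rightarrow> bool" where
  "C1_on g S \<longleftrightarrow> (\<exists>g' :: 'a \<Rightarrow> 'a \<Rightarrow>\<^sub>L 'b.
     (\<forall>z\<in>S. (g has_derivative blinfun_apply (g' z)) (at z within S)) \<and> continuous_on S g')"

definition compactly_supported :: "('a::topological_space \<Rightarrow> real) \<Rightarrow> bool" where
  "compactly_supported g \<longleftrightarrow> compact (closure {z. g z \<noteq> 0})"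

definition vhat1 :: "real \<times> real \<Rightarrow> real" where
  "vhat1 v = fst v / sqrt (1 + (norm v)\<^sup>2)"

definition charge_density :: "(real \<Rightarrow> real \<Rightarrow> real \<times> real \<Rightarrow> real) \<Rightarrow> real \<Rightarrow> real \<Rightarrow> real" where
  "charge_density f t x = (LINT v|lborel. f t x v)"

definition E1 :: "(real \<Rightarrow> real \<Rightarrow> real \<times> real \<Rightarrow> real) \<Rightarrow> real \<Rightarrow> real \<Rightarrow> real" where
  "E1 f t x = 1/2 * ((LINT y:{..x}|lborel. charge_density f t y)
                   - (LINT y:{x..}|lborel. charge_density f t y))"

definition vlasov_equation_at ::
  "(real \<Rightarrow> real \<Rightarrow> real \<times> real \<Rightarrow> real) \<Rightarrow> real \<Rightarrow> real \<Rightarrow> real \<times> real \<Rightarrow> bool" where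
  "vlasov_equation_at f t x v \<longleftrightarrow> (\<exists>f_t f_x f_v1.
     ((\<lambda>s. f s x v) has_real_derivative f_t) (at t within {0..}) \<and>
     ((\<lambda>y. f t y v) has_real_derivative f_x) (at x) \<and>
     ((\<lambda>w. f t x (w, snd v)) has_real_derivative f_v1) (at (fst v)) \<and>
     f_t + vhat1 v * f_x + E1 f t x * f_v1 = 0)"

definition vlasov_poisson_solution ::
  "(real \<Rightarrow> real \<times> real \<Rightarrow> real) \<Rightarrow> (real \<Rightarrow> real \<Rightarrow> real \<times> real \<Rightarrow> real) \<Rightarrow> bool" where
  "vlasov_poisson_solution f0 f \<longleftrightarrow>
     C1_on (\<lambda>(t, x, v). f t x v) ({0..} \<times> UNIV) \<and>
     (\<forall>t\<ge>0. \<forall>x v. f t x v \<ge> 0) \<and>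
     (\<forall>t\<ge>0. compactly_supported (\<lambda>(x, v). f t x v)) \<and>
     (\<forall>t\<ge>0. \<forall>x v. vlasov_equation_at f t x v) \<and>
     (\<forall>x v. f 0 x v = f0 x v)"

text \<open>
  \<open>X s t x v\<close> and \<open>V s t x v\<close> are position and momentum at time \<open>s\<close> of the particle that is
  at \<open>(x, v)\<close> at time \<open>t\<close>.
\<close>

definition characteristics ::
  "(real \<Rightarrow> real \<Rightarrow> real \<times> real \<Rightarrow> real) \<Rightarrow>
   (real \<Rightarrow> real \<Rightarrow> real \<Rightarrow> real \<times> real \<Rightarrow> real) \<Rightarrow>
   (real \<Rightarrow> real \<Rightarrow> real \<Rightarrow> real \<times> real \<Rightarrow> real \<times> real) \<Rightarrow> bool" where
  "characteristics f X V \<longleftrightarrow> (\<forall>t\<ge>0. \<forall>x v.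
     X t t x v = x \<and> fst (V t t x v) = fst v \<and>
     (\<forall>s\<ge>0.
        ((\<lambda>r. X r t x v) has_real_derivative vhat1 (V s t x v)) (at s within {0..}) \<and>
        ((\<lambda>r. fst (V r t x v)) has_real_derivative E1 f s (X s t x v)) (at s within {0..}) \<and>
        snd (V s t x v) = snd v))"

end

theory Submission
  imports Defs
begin

text \<open>
  For two characteristics ending at the same position with the same second momentum component,
  let \<open>Z\<close> and \<open>W\<close> be the differences of positions and first momenta, divided by the difference
  of the final first momenta. As \<open>vhat1\<close> increases in the first momentum and the field increases
  in position (its derivative is the charge density), \<open>Z' = a W\<close> and \<open>W' = b Z\<close> with
  \<open>a, b \<ge> 0\<close>. Hence \<open>Z W\<close> increases to its final value \<open>0\<close>, so \<open>W\<^sup>2\<close> decreases to its final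
  value \<open>1\<close>, that is, \<open>W \<ge> 1\<close> at earlier times. Gronwall's inequality shows that the quotients
  are Cauchy as the final momenta merge, so their limit, the derivative of the flow, exists
  (without solving the variational equation) and is at least \<open>1\<close>.

  Since \<open>f\<close> is constant along characteristics, \<open>f t x v\<close> is at most the supremum of \<open>f0\<close> over
  positions, evaluated at the initial momentum. That momentum is, for fixed second component, an
  expanding function of the first component of \<open>v\<close>, so substituting it can only increase the integral.
\<close>

section \<open>One-variable calculus: monotonicity, Gronwall, mean values, limits\<close>

text \<open>Derivatives are taken within a larger set \<open>S\<close> because those in time are
  one-sided at time 0.\<close>

lemma has_real_derivative_nonneg_imp_le:
  fixes g :: "real \<Rightarrow> real"
  assumes "a \<le> b" and "{a..b} \<subseteq> S"
    and der: "\<And>s. s \<in> {a..b} \<Longrightarrow> (g has_real_derivative g' s) (at s within S)"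
    and nn: "\<And>s. s \<in> {a..b} \<Longrightarrow> 0 \<le> g' s"
  shows "g a \<le> g b"
proof (cases "a = b")
  case False
  have "\<exists>s\<in>{a<..<b}. g b - g a = g' s * (b - a)"
  proof (rule mvt_simple)
    show "a < b" using False \<open>a \<le> b\<close> by simp
    fix s assume "a \<le> s" "s \<le> b"
    then show "(g has_derivative (*) (g' s)) (at s within {a..b})"
      using DERIV_subset[OF der \<open>{a..b} \<subseteq> S\<close>] by (simp add: has_field_derivative_def)
  qed
  then obtain s where "s \<in> {a<..<b}" "g b - g a = g' s * (b - a)" by blast
  moreover have "0 \<le> g' s * (b - a)"
    using nn[of s] \<open>s \<in> {a<..<b}\<close> \<open>a \<le> b\<close> by simp
  ultimately show ?thesis by simp
qed simp

text \<open>Steps to the right of \<open>s\<close> stay in the half line, also from its end point.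
  This identifies the one-sided time derivative in the Vlasov equation with the one obtained from
  joint differentiability.\<close>

lemma has_real_derivative_within_atLeast_unique:
  fixes g :: "real \<Rightarrow> real"
  assumes "(g has_real_derivative d) (at s within {a..})" "(g has_real_derivative e) (at s within {a..})"
    and "a \<le> s"
  shows "d = e"
proof -
  have "(*) d = (*) e"
  proof (rule frechet_derivative_unique_within)
    show "(g has_derivative (*) d) (at s within {a..})" "(g has_derivative (*) e) (at s within {a..})"
      using assms by (auto simp: has_field_derivative_def)
    fix i e :: real assume "i \<in> Basis" "0 < e"
    then show "\<exists>d. 0 < \<bar>d\<bar> \<and> \<bar>d\<bar> < e \<and> s + d *\<^sub>R i \<in> {a..}"
      using \<open>a \<le> s\<close> by (intro exI[of _ "e/2"]) auto
  qed
  then show ?thesis by (metis mult.right_neutral)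
qed

text \<open>The bound makes \<open>(N r + c) * exp (K * r)\<close> nondecreasing in
  \<open>r\<close>, so the final value controls all earlier ones. The offset \<open>c\<close>
  absorbs inhomogeneous error terms.\<close>

lemma backward_gronwall:
  fixes N :: "real \<Rightarrow> real"
  assumes "s \<le> t" "{s..t} \<subseteq> S"
    and der: "\<And>r. r \<in> {s..t} \<Longrightarrow> (N has_real_derivative N' r) (at r within S)"
    and bound: "\<And>r. r \<in> {s..t} \<Longrightarrow> \<bar>N' r\<bar> \<le> K * (N r + c)"
  shows "N s + c \<le> (N t + c) * exp (K * (t - s))"
proof -
  have "(N s + c) * exp (K * s) \<le> (N t + c) * exp (K * t)"
  proof (rule has_real_derivative_nonneg_imp_le[OF assms(1,2)])
    fix r assume r: "r \<in> {s..t}"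
    show "((\<lambda>r. (N r + c) * exp (K * r)) has_real_derivative (N' r + K * (N r + c)) * exp (K * r))
        (at r within S)"
      by (auto intro!: derivative_eq_intros der[OF r] simp: algebra_simps)
    show "0 \<le> (N' r + K * (N r + c)) * exp (K * r)"
      using bound[OF r] by auto
  qed
  then have "(N s + c) * exp (K * s) * exp (- (K * s)) \<le> (N t + c) * exp (K * t) * exp (- (K * s))"
    by (intro mult_right_mono) auto
  also have "(N s + c) * exp (K * s) * exp (- (K * s)) = N s + c"
    by (simp add: exp_minus)
  also have "(N t + c) * exp (K * t) * exp (- (K * s)) = (N t + c) * exp (K * (t - s))"
    by (simp add: exp_minus exp_diff field_simps)
  finally show ?thesis .
qed

text \<open>The distance bound on \<xi> is weak enough to include \<open>y = z\<close>, so the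
  trajectories compared later may meet.\<close>

lemma mean_value_quotient:
  fixes G :: "real \<Rightarrow> real"
  assumes "\<And>z. (G has_real_derivative G' z) (at z)"
  obtains \<xi> where "G y - G z = G' \<xi> * (y - z)" "\<bar>\<xi> - z\<bar> \<le> \<bar>y - z\<bar>"
proof -
  consider "y = z" | "z < y" | "y < z" by linarith
  then show ?thesis
  proof cases
    case 1 then show ?thesis by (intro that[of z]) auto
  next
    case 2
    from MVT2[of z y G G'] 2 assms obtain \<xi> where "z < \<xi>" "\<xi> < y" "G y - G z = (y - z) * G' \<xi>"
      by blast
    then show ?thesis by (intro that[of \<xi>]) (auto simp: mult.commute)
  next
    case 3
    from MVT2[of y z G G'] 3 assms obtain \<xi> where "y < \<xi>" "\<xi> < z" "G z - G y = (z - y) * G' \<xi>"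
      by blast
    then show ?thesis by (intro that[of \<xi>]) (auto simp: algebra_simps)
  qed
qed

text \<open>The values at \<open>1 / (n + 1)\<close> form a Cauchy sequence with limit
  \<open>D\<close>. Letting \<open>k\<close> run through these points gives
  \<open>\<bar>q h - D\<bar> \<le> C * \<bar>h\<bar>\<close> for all nonzero \<open>h\<close> of
  either sign, so this one sequence determines the full limit.\<close>

lemma tendsto_zero_if_linear_cauchy:
  fixes q :: "real \<Rightarrow> real"
  assumes C: "\<And>h k. h \<noteq> 0 \<Longrightarrow> k \<noteq> 0 \<Longrightarrow> \<bar>q h - q k\<bar> \<le> C * (\<bar>h\<bar> + \<bar>k\<bar>)"
  obtains D where "(q \<longlongrightarrow> D) (at 0)"
proof -
  have C0: "0 \<le> C" using C[of 1 1] by simp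
  let ?u = "\<lambda>n. q (inverse (real (Suc n)))"
  have lim0: "(\<lambda>n. inverse (real (Suc n))) \<longlonglongrightarrow> 0" by (rule LIMSEQ_inverse_real_of_nat)
  have "Cauchy ?u"
  proof (rule metric_CauchyI)
    fix e :: real assume "0 < e"
    \<comment> \<open>The summand 1 allows \<open>C = 0\<close> and makes the final estimate
      \<open>2 * C * e / (2 * C + 1) < e\<close> strict.\<close>
    then have "0 < e / (2 * C + 1)" using C0 by auto
    then obtain M where M: "\<And>n. n \<ge> M \<Longrightarrow> inverse (real (Suc n)) < e / (2 * C + 1)"
      using LIMSEQ_D[OF lim0] by (metis diff_zero norm_inverse norm_of_nat real_norm_def)
    show "\<exists>M. \<forall>m\<ge>M. \<forall>n\<ge>M. dist (?u m) (?u n) < e"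
    proof (intro exI allI impI)
      fix m n assume "m \<ge> M" "n \<ge> M"
      have "dist (?u m) (?u n) \<le> C * (inverse (real (Suc m)) + inverse (real (Suc n)))"
        using C[of "inverse (real (Suc m))" "inverse (real (Suc n))"] by (simp add: dist_real_def)
      also have "\<dots> \<le> C * (2 * (e / (2 * C + 1)))"
        using M[OF \<open>m \<ge> M\<close>] M[OF \<open>n \<ge> M\<close>] C0 by (intro mult_left_mono) auto
      also have "\<dots> < e" using \<open>0 < e\<close> C0 by (simp add: field_simps)
      finally show "dist (?u m) (?u n) < e" .
    qed
  qed
  then obtain D where D: "?u \<longlonglongrightarrow> D" using Cauchy_convergent convergent_def by blast
  have "\<bar>q h - D\<bar> \<le> C * \<bar>h\<bar>" if "h \<noteq> 0" for h
  proof (rule LIMSEQ_le)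
    show "(\<lambda>n. \<bar>q h - ?u n\<bar>) \<longlonglongrightarrow> \<bar>q h - D\<bar>" by (intro tendsto_intros D)
    have "(\<lambda>n. C * (\<bar>h\<bar> + inverse (real (Suc n)))) \<longlonglongrightarrow> C * (\<bar>h\<bar> + 0)"
      by (intro tendsto_intros lim0)
    then show "(\<lambda>n. C * (\<bar>h\<bar> + inverse (real (Suc n)))) \<longlonglongrightarrow> C * \<bar>h\<bar>" by simp
    have "\<bar>q h - ?u n\<bar> \<le> C * (\<bar>h\<bar> + inverse (real (Suc n)))" for n
      using C[OF that, of "inverse (real (Suc n))"] by simp
    then show "\<exists>N. \<forall>n\<ge>N. \<bar>q h - ?u n\<bar> \<le> C * (\<bar>h\<bar> + inverse (real (Suc n)))" by blast
  qed
  then have "\<forall>\<^sub>F h in at 0. norm (q h - D) \<le> C * \<bar>h\<bar>"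
    unfolding eventually_at_filter by (intro always_eventually) simp
  moreover have "((\<lambda>h. C * \<bar>h\<bar>) \<longlongrightarrow> 0) (at 0)"
    using tendsto_mult_right_zero[OF tendsto_rabs_zero[OF tendsto_ident_at]] by blast
  ultimately have "((\<lambda>h. q h - D) \<longlongrightarrow> 0) (at 0)"
    by (rule Lim_null_comparison)
  then show ?thesis using that LIM_zero_cancel by blast
qed

subsection \<open>Dependence of a monotone planar system on its final momentum\<close>

text \<open>\<open>x w s\<close> and \<open>v w s\<close> are position and first momentum at time
  \<open>s\<close> of the trajectory with final momentum \<open>w\<close>; all trajectories share
  the final position. The fixed parameter \<open>w\<close> is the base point at which the flow is
  differentiated. Lipschitz bounds on the slopes stand in for second derivatives, since the charge
  density, which will be \<open>F'\<close>, is only shown to be Lipschitz in position.\<close>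

locale monotone_flow =
  fixes A A' :: "real \<Rightarrow> real" and F F' :: "real \<Rightarrow> real \<Rightarrow> real" and x v :: "real \<Rightarrow> real \<Rightarrow> real"
    and t L w :: real and S :: "real set"
  assumes S: "{0..t} \<subseteq> S"
    and A: "\<And>z. (A has_real_derivative A' z) (at z)"
    and A'_bounds: "\<And>z. 0 \<le> A' z" "\<And>z. A' z \<le> L"
    and A'_lip: "\<And>y z. \<bar>A' y - A' z\<bar> \<le> L * \<bar>y - z\<bar>"
    and F: "\<And>s z. s \<in> {0..t} \<Longrightarrow> (F s has_real_derivative F' s z) (at z)"
    and F'_bounds: "\<And>s z. s \<in> {0..t} \<Longrightarrow> 0 \<le> F' s z" "\<And>s z. s \<in> {0..t} \<Longrightarrow> F' s z \<le> L"
    and F'_lip: "\<And>s y z. s \<in> {0..t} \<Longrightarrow> \<bar>F' s y - F' s z\<bar> \<le> L * \<bar>y - z\<bar>"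
    and x: "\<And>w s. s \<in> {0..t} \<Longrightarrow> (x w has_real_derivative A (v w s)) (at s within S)"
    and v: "\<And>w s. s \<in> {0..t} \<Longrightarrow> (v w has_real_derivative F s (x w s)) (at s within S)"
    and xt: "\<And>w. x w t = x 0 t"
    and vt: "\<And>w. v w t = w"
begin

definition Z :: "real \<Rightarrow> real \<Rightarrow> real" where "Z h s = (x (w + h) s - x w s) / h"
definition W :: "real \<Rightarrow> real \<Rightarrow> real" where "W h s = (v (w + h) s - v w s) / h"
definition Z' :: "real \<Rightarrow> real \<Rightarrow> real" where "Z' h s = (A (v (w + h) s) - A (v w s)) / h"
definition W' :: "real \<Rightarrow> real \<Rightarrow> real" where "W' h s = (F s (x (w + h) s) - F s (x w s)) / h"

lemma L_nonneg: "0 \<le> L" using A'_bounds[of 0] by linarith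

lemma Z_deriv: "s \<in> {0..t} \<Longrightarrow> (Z h has_real_derivative Z' h s) (at s within S)"
  unfolding Z_def[abs_def] Z'_def by (intro DERIV_cdivide DERIV_diff x)

lemma W_deriv: "s \<in> {0..t} \<Longrightarrow> (W h has_real_derivative W' h s) (at s within S)"
  unfolding W_def[abs_def] W'_def by (intro DERIV_cdivide DERIV_diff v)

lemma Z_end: "Z h t = 0" using xt[of "w+h"] xt[of w] by (simp add: Z_def)

lemma W_end: "h \<noteq> 0 \<Longrightarrow> W h t = 1" by (simp add: W_def vt)

text \<open>\<open>c\<close> is the slope of \<open>A\<close> at a mean value point. Its sign drives
  the monotonicity argument, its upper bound feeds Gronwall's inequality, and its distance to the
  slope on the base trajectory measures the linearization error. The next lemma does the same for
  the field.\<close>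

lemma Z'_quotient:
  assumes "h \<noteq> 0"
  obtains c where "0 \<le> c" "c \<le> L" "Z' h s = c * W h s" "\<bar>c - A' (v w s)\<bar> \<le> L * (\<bar>h\<bar> * \<bar>W h s\<bar>)"
proof -
  obtain \<xi> where \<xi>: "A (v (w + h) s) - A (v w s) = A' \<xi> * (v (w + h) s - v w s)"
    "\<bar>\<xi> - v w s\<bar> \<le> \<bar>v (w + h) s - v w s\<bar>"
    using mean_value_quotient[of A A'] A by metis
  have "\<bar>v (w + h) s - v w s\<bar> = \<bar>h\<bar> * \<bar>W h s\<bar>"
    using assms by (simp add: W_def abs_divide)
  then have "\<bar>A' \<xi> - A' (v w s)\<bar> \<le> L * (\<bar>h\<bar> * \<bar>W h s\<bar>)"
    using order_trans[OF A'_lip mult_left_mono[OF \<xi>(2) L_nonneg]] by simp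
  then show ?thesis
    using that[of "A' \<xi>"] A'_bounds \<xi>(1) by (simp add: Z'_def W_def)
qed

lemma W'_quotient:
  assumes "h \<noteq> 0" "s \<in> {0..t}"
  obtains c where "0 \<le> c" "c \<le> L" "W' h s = c * Z h s" "\<bar>c - F' s (x w s)\<bar> \<le> L * (\<bar>h\<bar> * \<bar>Z h s\<bar>)"
proof -
  obtain \<xi> where \<xi>: "F s (x (w + h) s) - F s (x w s) = F' s \<xi> * (x (w + h) s - x w s)"
    "\<bar>\<xi> - x w s\<bar> \<le> \<bar>x (w + h) s - x w s\<bar>"
    using mean_value_quotient[of "F s" "F' s"] F[OF assms(2)] by metis
  have "\<bar>x (w + h) s - x w s\<bar> = \<bar>h\<bar> * \<bar>Z h s\<bar>"
    using assms by (simp add: Z_def abs_divide)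
  then have "\<bar>F' s \<xi> - F' s (x w s)\<bar> \<le> L * (\<bar>h\<bar> * \<bar>Z h s\<bar>)"
    using order_trans[OF F'_lip[OF assms(2)] mult_left_mono[OF \<xi>(2) L_nonneg]] by simp
  then show ?thesis
    using that[of "F' s \<xi>"] F'_bounds[OF assms(2)] \<xi>(1) by (simp add: W'_def Z_def)
qed

lemma ZW_nonpos:
  assumes "h \<noteq> 0" "s \<in> {0..t}"
  shows "Z h s * W h s \<le> 0"
proof -
  have "Z h s * W h s \<le> Z h t * W h t"
  proof (rule has_real_derivative_nonneg_imp_le[where g = "\<lambda>r. Z h r * W h r"])
    show "s \<le> t" "{s..t} \<subseteq> S" using assms S by auto
    fix r assume "r \<in> {s..t}"
    then have r: "r \<in> {0..t}" using assms by auto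
    show "((\<lambda>r. Z h r * W h r) has_real_derivative (Z' h r * W h r + Z h r * W' h r)) (at r within S)"
      using Z_deriv[OF r] W_deriv[OF r] by (auto intro!: derivative_eq_intros)
    obtain c where c: "0 \<le> c" "Z' h r = c * W h r" using Z'_quotient[OF assms(1)] by metis
    obtain d where d: "0 \<le> d" "W' h r = d * Z h r" using W'_quotient[OF assms(1) r] by metis
    have "0 \<le> c * (W h r * W h r) + d * (Z h r * Z h r)" using c(1) d(1) by simp
    then show "0 \<le> Z' h r * W h r + Z h r * W' h r"
      using c d by (simp add: algebra_simps)
  qed
  then show ?thesis by (simp add: Z_end)
qed

lemma W_square_ge_1:
  assumes "h \<noteq> 0" "s \<in> {0..t}"
  shows "1 \<le> (W h s)\<^sup>2"
proof -
  have "- ((W h s)\<^sup>2) \<le> - ((W h t)\<^sup>2)"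
  proof (rule has_real_derivative_nonneg_imp_le[where g = "\<lambda>r. - ((W h r)\<^sup>2)"])
    show "s \<le> t" "{s..t} \<subseteq> S" using assms S by auto
    fix r assume "r \<in> {s..t}"
    then have r: "r \<in> {0..t}" using assms by auto
    show "((\<lambda>r. - ((W h r)\<^sup>2)) has_real_derivative - (2 * W h r * W' h r)) (at r within S)"
      using W_deriv[OF r] by (auto intro!: derivative_eq_intros)
    obtain d where d: "0 \<le> d" "W' h r = d * Z h r" using W'_quotient[OF assms(1) r] by metis
    have "d * (Z h r * W h r) \<le> 0" using ZW_nonpos[OF assms(1) r] d(1) by (rule mult_nonneg_nonpos[rotated])
    then show "0 \<le> - (2 * W h r * W' h r)"
      using d by (simp add: algebra_simps)
  qed
  then show ?thesis by (simp add: W_end assms)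
qed

text \<open>A quotient whose square is at least 1 has no zeros; as its final value is 1, the
  intermediate value theorem excludes the negative branch.\<close>

lemma W_ge_1:
  assumes "h \<noteq> 0" "s \<in> {0..t}"
  shows "1 \<le> W h s"
proof (rule ccontr)
  assume "\<not> 1 \<le> W h s"
  with W_square_ge_1[OF assms] have "W h s \<le> 0"
    by (metis abs_le_square_iff abs_of_nonneg linorder_le_cases one_power2 abs_one)
  moreover have "continuous_on {s..t} (W h)"
    using assms S by (intro DERIV_continuous_on[where D = "W' h"] DERIV_subset[OF W_deriv]) auto
  ultimately obtain r where "s \<le> r" "r \<le> t" "W h r = 0"
    using IVT'[of "W h" s 0 t] W_end[OF assms(1)] assms by auto
  then show False using W_square_ge_1[of h r] assms by auto
qed

text \<open>The sum of squares has derivative \<open>2 * (c + d) * Z * W\<close>, at most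
  \<open>2 * L\<close> times the sum itself in absolute value, and its final value is 1. The bound
  does not depend on \<open>h\<close>, which makes the linearization errors below of first order in
  \<open>h\<close>.\<close>

lemma quotients_bounded:
  assumes "h \<noteq> 0" "s \<in> {0..t}"
  shows "(Z h s)\<^sup>2 + (W h s)\<^sup>2 \<le> exp (2 * L * t)"
proof -
  have "(Z h s)\<^sup>2 + (W h s)\<^sup>2 + 0 \<le> ((Z h t)\<^sup>2 + (W h t)\<^sup>2 + 0) * exp (2 * L * (t - s))"
  proof (rule backward_gronwall)
    show "s \<le> t" "{s..t} \<subseteq> S" using assms S by auto
    fix r assume "r \<in> {s..t}"
    then have r: "r \<in> {0..t}" using assms by auto
    show "((\<lambda>r. (Z h r)\<^sup>2 + (W h r)\<^sup>2) has_real_derivative 2 * Z h r * Z' h r + 2 * W h r * W' h r) (at r within S)"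
      using Z_deriv[OF r] W_deriv[OF r] by (auto intro!: derivative_eq_intros)
    obtain c where c: "0 \<le> c" "c \<le> L" "Z' h r = c * W h r" using Z'_quotient[OF assms(1)] by metis
    obtain d where d: "0 \<le> d" "d \<le> L" "W' h r = d * Z h r" using W'_quotient[OF assms(1) r] by metis
    have "\<bar>2 * Z h r * Z' h r + 2 * W h r * W' h r\<bar> = (c + d) * (2 * \<bar>Z h r\<bar> * \<bar>W h r\<bar>)"
    proof -
      have "2 * Z h r * Z' h r + 2 * W h r * W' h r = (c + d) * (2 * Z h r * W h r)"
        using c d by (simp add: algebra_simps)
      then show ?thesis using c d by (simp add: abs_mult)
    qed
    also have "\<dots> \<le> (2 * L) * ((Z h r)\<^sup>2 + (W h r)\<^sup>2)"
      using c d L_nonneg sum_squares_bound[of "\<bar>Z h r\<bar>" "\<bar>W h r\<bar>"] by (intro mult_mono) auto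
    finally show "\<bar>2 * Z h r * Z' h r + 2 * W h r * W' h r\<bar> \<le> 2 * L * ((Z h r)\<^sup>2 + (W h r)\<^sup>2 + 0)" by simp
  qed
  also have "\<dots> = exp (2 * L * (t - s))" using assms by (simp add: Z_end W_end)
  also have "\<dots> \<le> exp (2 * L * t)" using assms L_nonneg by (auto intro: mult_left_mono)
  finally show ?thesis by simp
qed

text \<open>Replacing the mean value slope by the slope on the base trajectory costs
  \<open>L * \<bar>h\<bar> * \<bar>W h s\<bar>\<close>; the further factor \<open>W h s\<close>
  makes a square, bounded by the energy estimate. The same holds for \<open>W'\<close> with
  \<open>Z\<close> in place of \<open>W\<close>.\<close>

lemma Z'_linearization:
  assumes "h \<noteq> 0" "s \<in> {0..t}"
  shows "\<bar>Z' h s - A' (v w s) * W h s\<bar> \<le> L * exp (2 * L * t) * \<bar>h\<bar>"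
proof -
  obtain c where c: "Z' h s = c * W h s" "\<bar>c - A' (v w s)\<bar> \<le> L * (\<bar>h\<bar> * \<bar>W h s\<bar>)"
    using Z'_quotient[OF assms(1)] by metis
  have "\<bar>Z' h s - A' (v w s) * W h s\<bar> = \<bar>c - A' (v w s)\<bar> * \<bar>W h s\<bar>"
    using c(1) by (simp flip: abs_mult add: algebra_simps)
  also have "\<dots> \<le> L * (\<bar>h\<bar> * \<bar>W h s\<bar>) * \<bar>W h s\<bar>"
    by (intro mult_right_mono c) auto
  also have "\<dots> = L * \<bar>h\<bar> * (W h s)\<^sup>2"
    by (simp add: mult.assoc power2_eq_square)
  also have "\<dots> \<le> L * \<bar>h\<bar> * exp (2 * L * t)"
    using quotients_bounded[OF assms] L_nonneg
    by (intro mult_left_mono) (auto intro: order_trans[rotated])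
  finally show ?thesis by (simp add: mult_ac)
qed

lemma W'_linearization:
  assumes "h \<noteq> 0" "s \<in> {0..t}"
  shows "\<bar>W' h s - F' s (x w s) * Z h s\<bar> \<le> L * exp (2 * L * t) * \<bar>h\<bar>"
proof -
  obtain c where c: "W' h s = c * Z h s" "\<bar>c - F' s (x w s)\<bar> \<le> L * (\<bar>h\<bar> * \<bar>Z h s\<bar>)"
    using W'_quotient[OF assms] by metis
  have "\<bar>W' h s - F' s (x w s) * Z h s\<bar> = \<bar>c - F' s (x w s)\<bar> * \<bar>Z h s\<bar>"
    using c(1) by (simp flip: abs_mult add: algebra_simps)
  also have "\<dots> \<le> L * (\<bar>h\<bar> * \<bar>Z h s\<bar>) * \<bar>Z h s\<bar>"
    by (intro mult_right_mono c) auto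
  also have "\<dots> = L * \<bar>h\<bar> * (Z h s)\<^sup>2"
    by (simp add: mult.assoc power2_eq_square)
  also have "\<dots> \<le> L * \<bar>h\<bar> * exp (2 * L * t)"
    using quotients_bounded[OF assms] L_nonneg
    by (intro mult_left_mono) (auto intro: order_trans[rotated])
  finally show ?thesis by (simp add: mult_ac)
qed

text \<open>Up to errors of size \<open>e\<close>, the quotients for \<open>h\<close> and
  \<open>k\<close> satisfy the same linear system, that of the base trajectory, with equal final
  values. Their difference \<open>(P, Q)\<close> therefore starts from 0 at time \<open>t\<close>,
  and Gronwall's inequality bounds it by a multiple of \<open>e\<close>.\<close>

lemma W_linear_cauchy:
  assumes "s \<in> {0..t}" "h \<noteq> 0" "k \<noteq> 0"
  shows "\<bar>W h s - W k s\<bar> \<le> L * exp (2 * L * t) * sqrt (2 * exp ((2 * L + 1) * t)) * (\<bar>h\<bar> + \<bar>k\<bar>)"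
proof -
  define e where "e = L * exp (2 * L * t) * (\<bar>h\<bar> + \<bar>k\<bar>)"
  have e0: "0 \<le> e" using L_nonneg by (simp add: e_def)
  define P Q where "P = (\<lambda>r. Z h r - Z k r)" and "Q = (\<lambda>r. W h r - W k r)"
  define P' Q' where "P' = (\<lambda>r. Z' h r - Z' k r)" and "Q' = (\<lambda>r. W' h r - W' k r)"
  \<comment> \<open>The errors enter as \<open>2 * \<bar>P r\<bar> * e\<close> and
    \<open>2 * \<bar>Q r\<bar> * e\<close>. Young's inequality turns them into squares, whence the
    offset \<open>2 * e\<^sup>2\<close> and the extra 1 in the growth rate.\<close>
  have "(P s)\<^sup>2 + (Q s)\<^sup>2 + 2 * e\<^sup>2 \<le> ((P t)\<^sup>2 + (Q t)\<^sup>2 + 2 * e\<^sup>2) * exp ((2 * L + 1) * (t - s))"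
  proof (rule backward_gronwall)
    show "s \<le> t" "{s..t} \<subseteq> S" using assms S by auto
    fix r assume "r \<in> {s..t}"
    then have r: "r \<in> {0..t}" using assms by auto
    have "(P has_real_derivative P' r) (at r within S)" "(Q has_real_derivative Q' r) (at r within S)"
      unfolding P_def P'_def Q_def Q'_def by (intro DERIV_diff Z_deriv W_deriv r)+
    then show "((\<lambda>r. (P r)\<^sup>2 + (Q r)\<^sup>2) has_real_derivative 2 * P r * P' r + 2 * Q r * Q' r) (at r within S)"
      by (auto intro!: derivative_eq_intros)
    define a b where "a = A' (v w r)" and "b = F' r (x w r)"
    have ab: "0 \<le> a" "a \<le> L" "0 \<le> b" "b \<le> L"
      unfolding a_def b_def using A'_bounds F'_bounds[OF r] by auto
    have P': "\<bar>P' r - a * Q r\<bar> \<le> e"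
      using Z'_linearization[OF assms(2) r] Z'_linearization[OF assms(3) r]
      unfolding P'_def Q_def a_def e_def by (simp add: algebra_simps)
    have Q': "\<bar>Q' r - b * P r\<bar> \<le> e"
      using W'_linearization[OF assms(2) r] W'_linearization[OF assms(3) r]
      unfolding Q'_def P_def b_def e_def by (simp add: algebra_simps)
    have "2 * P r * P' r + 2 * Q r * Q' r
        = (a + b) * (2 * P r * Q r) + 2 * P r * (P' r - a * Q r) + 2 * Q r * (Q' r - b * P r)"
      by (simp add: algebra_simps)
    also have "\<bar>\<dots>\<bar> \<le> (a + b) * (2 * \<bar>P r\<bar> * \<bar>Q r\<bar>) + 2 * \<bar>P r\<bar> * \<bar>P' r - a * Q r\<bar> + 2 * \<bar>Q r\<bar> * \<bar>Q' r - b * P r\<bar>"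
      by (intro order_trans[OF abs_triangle_ineq] add_mono) (use ab in \<open>auto simp: abs_mult\<close>)
    also have "\<dots> \<le> (2 * L) * ((P r)\<^sup>2 + (Q r)\<^sup>2) + 2 * \<bar>P r\<bar> * e + 2 * \<bar>Q r\<bar> * e"
      using ab L_nonneg sum_squares_bound[of "\<bar>P r\<bar>" "\<bar>Q r\<bar>"] P' Q'
      by (intro add_mono mult_mono) auto
    also have "\<dots> \<le> (2 * L) * ((P r)\<^sup>2 + (Q r)\<^sup>2) + ((P r)\<^sup>2 + e\<^sup>2) + ((Q r)\<^sup>2 + e\<^sup>2)"
      using sum_squares_bound[of "\<bar>P r\<bar>" e] sum_squares_bound[of "\<bar>Q r\<bar>" e] by (intro add_mono) auto
    also have "\<dots> \<le> (2 * L + 1) * ((P r)\<^sup>2 + (Q r)\<^sup>2 + 2 * e\<^sup>2)"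
      using L_nonneg by (simp add: algebra_simps)
    finally show "\<bar>2 * P r * P' r + 2 * Q r * Q' r\<bar> \<le> (2 * L + 1) * ((P r)\<^sup>2 + (Q r)\<^sup>2 + 2 * e\<^sup>2)" .
  qed
  also have "\<dots> = 2 * e\<^sup>2 * exp ((2 * L + 1) * (t - s))"
    using assms by (simp add: P_def Q_def Z_end W_end)
  also have "\<dots> \<le> 2 * e\<^sup>2 * exp ((2 * L + 1) * t)"
    using assms L_nonneg by (auto intro!: mult_left_mono)
  finally have "(P s)\<^sup>2 + (Q s)\<^sup>2 + 2 * e\<^sup>2 \<le> e\<^sup>2 * (2 * exp ((2 * L + 1) * t))"
    by (simp add: mult_ac)
  moreover have "0 \<le> (P s)\<^sup>2" "0 \<le> 2 * e\<^sup>2" by auto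
  ultimately have "(Q s)\<^sup>2 \<le> e\<^sup>2 * (2 * exp ((2 * L + 1) * t))" by linarith
  then have "\<bar>Q s\<bar> \<le> sqrt (e\<^sup>2 * (2 * exp ((2 * L + 1) * t)))"
    by (intro real_le_rsqrt) simp
  also have "\<dots> = e * sqrt (2 * exp ((2 * L + 1) * t))"
    using e0 by (subst real_sqrt_mult) simp
  finally show ?thesis by (simp add: Q_def e_def mult_ac)
qed

lemma v_deriv_ge_1:
  assumes "s \<in> {0..t}"
  obtains D where "((\<lambda>u. v u s) has_real_derivative D) (at w)" "1 \<le> D"
proof -
  obtain D where D: "((\<lambda>h. W h s) \<longlongrightarrow> D) (at 0)"
    using tendsto_zero_if_linear_cauchy[of "\<lambda>h. W h s"] W_linear_cauchy[OF assms] by metis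
  have "\<forall>\<^sub>F h in at 0. 1 \<le> W h s"
    unfolding eventually_at_filter by (rule always_eventually) (use W_ge_1[OF _ assms] in blast)
  then have "1 \<le> D"
    using tendsto_lowerbound[OF D] by simp
  moreover have "((\<lambda>u. v u s) has_real_derivative D) (at w)"
    using D by (simp add: DERIV_def W_def)
  ultimately show ?thesis using that by blast
qed

end

subsection \<open>Fields of compactly supported densities\<close>

lemma integrable_continuous_compact_support:
  fixes g :: "'a::euclidean_space \<Rightarrow> real"
  assumes "compact K" "continuous_on K g" "\<And>z. z \<notin> K \<Longrightarrow> g z = 0"
  shows "integrable lborel g"
proof -
  have "(\<lambda>z. indicator K z *\<^sub>R g z) = g"
    using assms(3) by (auto simp: indicator_def fun_eq_iff)
  then show ?thesis using borel_integrable_compact[OF assms(1,2)] by simp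
qed

text \<open>Carries a Lipschitz bound in position from the phase space density to the charge
  density. The momentum support \<open>K\<close> is common to all positions, so its measure is the
  price of integrating.\<close>

lemma velocity_integral_lipschitz:
  fixes g :: "real \<Rightarrow> 'a::euclidean_space \<Rightarrow> real"
  assumes "compact K" "\<And>x. continuous_on UNIV (g x)" "\<And>x v. v \<notin> K \<Longrightarrow> g x v = 0"
    and lip: "\<And>x y v. \<bar>g x v - g y v\<bar> \<le> L * \<bar>x - y\<bar>"
  shows "\<bar>(LINT v|lborel. g x v) - (LINT v|lborel. g y v)\<bar> \<le> L * measure lborel K * \<bar>x - y\<bar>"
proof -
  have int: "integrable lborel (g x)" for x
    using integrable_continuous_compact_support[of K "g x"] assms continuous_on_subset by blast
  have K: "K \<in> sets lborel" "emeasure lborel K < \<infinity>"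
    using borel_compact[OF assms(1)] emeasure_bounded_finite[OF compact_imp_bounded[OF assms(1)]]
    by simp_all
  have "\<bar>(LINT v|lborel. g x v) - (LINT v|lborel. g y v)\<bar> = \<bar>LINT v|lborel. g x v - g y v\<bar>"
    by (simp add: int)
  also have "\<dots> \<le> (LINT v|lborel. \<bar>g x v - g y v\<bar>)"
    using integral_norm_bound[of lborel "\<lambda>v. g x v - g y v"] by simp
  also have "\<dots> \<le> (LINT v|lborel. indicator K v * (L * \<bar>x - y\<bar>))"
  proof (rule integral_mono)
    show "integrable lborel (\<lambda>v. \<bar>g x v - g y v\<bar>)" using int by simp
    show "integrable lborel (\<lambda>v. indicator K v * (L * \<bar>x - y\<bar>))" using K by simp
    show "\<bar>g x v - g y v\<bar> \<le> indicator K v * (L * \<bar>x - y\<bar>)" for v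
      using lip[of x v y] assms(3)[of v] by (auto simp: indicator_def)
  qed
  also have "\<dots> = L * measure lborel K * \<bar>x - y\<bar>" using K by simp
  finally show ?thesis .
qed

text \<open>A charge density at one fixed time, with \<open>field\<close> as the corresponding slice
  of \<open>E1\<close>.\<close>

locale compact_density =
  fixes \<rho> :: "real \<Rightarrow> real" and B :: real
  assumes cont: "continuous_on UNIV \<rho>"
    and nonneg: "\<And>x. 0 \<le> \<rho> x"
    and support: "\<And>x. B < \<bar>x\<bar> \<Longrightarrow> \<rho> x = 0"
begin

definition mass :: real where "mass = (LINT y|lborel. \<rho> y)"
definition field :: "real \<Rightarrow> real" where
  "field x = 1/2 * ((LINT y:{..x}|lborel. \<rho> y) - (LINT y:{x..}|lborel. \<rho> y))"

lemma density_integrable: "integrable lborel \<rho>"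
  using cont support
  by (intro integrable_continuous_compact_support[of "{-B..B}"]) (auto intro: continuous_on_subset)

lemma density_set_integrable: "S \<in> sets borel \<Longrightarrow> set_integrable lborel S \<rho>"
  unfolding set_integrable_def by (rule integrable_mult_indicator) (auto intro: density_integrable)

text \<open>The two closed half lines overlap only in the null set \<open>{x}\<close>.\<close>

lemma mass_split: "(LINT y:{..x}|lborel. \<rho> y) + (LINT y:{x..}|lborel. \<rho> y) = mass"
proof -
  have "mass = (LINT y:UNIV|lborel. \<rho> y)"
    by (simp add: mass_def set_lebesgue_integral_def)
  also have "UNIV = {..x} \<union> {x<..}" by auto
  also have "(LINT y:{..x} \<union> {x<..}|lborel. \<rho> y) = (LINT y:{..x}|lborel. \<rho> y) + (LINT y:{x<..}|lborel. \<rho> y)"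
    by (intro set_integral_Un density_set_integrable) auto
  also have "(LINT y:{x<..}|lborel. \<rho> y) = (LINT y:{x..}|lborel. \<rho> y)"
    unfolding set_lebesgue_integral_def
  proof (rule integral_cong_AE)
    have "AE y in lborel. y \<noteq> x" by (rule AE_lborel_singleton)
    then show "AE y in lborel. indicator {x<..} y *\<^sub>R \<rho> y = indicator {x..} y *\<^sub>R \<rho> y"
      by eventually_elim (auto simp: indicator_def)
  qed (use density_integrable in auto)
  finally show ?thesis ..
qed

lemma field_eq: "field x = (LINT y:{..x}|lborel. \<rho> y) - mass / 2"
  using mass_split[of x] by (simp add: field_def field_simps)

lemma set_integral_bounds:
  assumes "S \<in> sets borel"
  shows "0 \<le> (LINT y:S|lborel. \<rho> y)" "(LINT y:S|lborel. \<rho> y) \<le> mass"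
proof -
  show "0 \<le> (LINT y:S|lborel. \<rho> y)"
    unfolding set_lebesgue_integral_def by (rule Bochner_Integration.integral_nonneg) (simp add: nonneg)
  show "(LINT y:S|lborel. \<rho> y) \<le> mass"
    unfolding set_lebesgue_integral_def mass_def
    using density_set_integrable[OF assms] density_integrable
    by (intro integral_mono) (auto simp: set_integrable_def indicator_def nonneg)
qed

lemma abs_field_le: "\<bar>field x\<bar> \<le> mass / 2"
  using set_integral_bounds[of "{..x}"] by (simp add: field_eq abs_le_iff field_simps)

text \<open>To the right of all the charge the field attains the upper bound of
  \<open>abs_field_le\<close>; a test particle there will experience the extremal force.\<close>

lemma field_right:
  assumes "\<And>y. x < y \<Longrightarrow> \<rho> y = 0"
  shows "field x = mass / 2"
proof -
  have "indicator {..x} y *\<^sub>R \<rho> y = \<rho> y" for y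
    using assms[of y] by (auto simp: indicator_def)
  then have "(LINT y:{..x}|lborel. \<rho> y) = mass"
    unfolding set_lebesgue_integral_def mass_def by presburger
  then show ?thesis by (simp add: field_eq)
qed

text \<open>Within distance 1 of \<open>x\<close> the field is a constant plus the integral of the
  density from \<open>x - 1\<close>, so the fundamental theorem of calculus applies.\<close>

lemma field_deriv: "(field has_real_derivative \<rho> x) (at x)"
proof -
  let ?a = "x - 1" and ?b = "x + 1"
  define c where "c = (LINT y:{..<?a}|lborel. \<rho> y) - mass / 2"
  have eq: "field y = c + integral {?a..y} \<rho>" if "y \<in> {?a..?b}" for y
  proof -
    have "{..y} = {..<?a} \<union> {?a..y}" using that by auto
    then have "(LINT z:{..y}|lborel. \<rho> z) = (LINT z:{..<?a} \<union> {?a..y}|lborel. \<rho> z)" by simp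
    also have "\<dots> = (LINT z:{..<?a}|lborel. \<rho> z) + (LINT z:{?a..y}|lborel. \<rho> z)"
      by (intro set_integral_Un density_set_integrable) auto
    also have "(LINT z:{?a..y}|lborel. \<rho> z) = integral {?a..y} \<rho>"
      by (intro set_borel_integral_eq_integral density_set_integrable) auto
    finally show ?thesis by (simp add: field_eq c_def)
  qed
  have "((\<lambda>y. c + integral {?a..y} \<rho>) has_real_derivative (0 + \<rho> x)) (at x within {?a..?b})"
    by (intro DERIV_add DERIV_const integral_has_real_derivative)
      (auto intro: continuous_on_subset[OF cont])
  then have "(field has_real_derivative \<rho> x) (at x within {?a..?b})"
    using has_field_derivative_transform_within[of _ _ x "{?a..?b}" 1 field] eq by simp
  then show ?thesis by (simp add: at_within_Icc_at)
qed

end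

section \<open>The relativistic velocity as a function of the first momentum\<close>

lemma has_real_derivative_energy:
  fixes u w :: real
  shows "((\<lambda>w. sqrt (1 + w\<^sup>2 + u\<^sup>2)) has_real_derivative w / sqrt (1 + w\<^sup>2 + u\<^sup>2)) (at w)"
proof -
  have pos: "0 < 1 + w\<^sup>2 + u\<^sup>2" by (smt (verit) zero_le_power2)
  have der: "((\<lambda>w. 1 + w\<^sup>2 + u\<^sup>2) has_real_derivative 2 * w) (at w)"
    by (auto intro!: derivative_eq_intros)
  have "inverse (sqrt (1 + w\<^sup>2 + u\<^sup>2)) / 2 * (2 * w) = w / sqrt (1 + w\<^sup>2 + u\<^sup>2)"
    by (simp add: inverse_eq_divide)
  with DERIV_chain2[OF DERIV_real_sqrt[OF pos] der] show ?thesis by simp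
qed

lemma has_real_derivative_vhat1:
  "((\<lambda>w. vhat1 (w, u)) has_real_derivative (1 + u\<^sup>2) / sqrt (1 + w\<^sup>2 + u\<^sup>2) ^ 3) (at w)"
proof -
  have pos: "0 < 1 + w\<^sup>2 + u\<^sup>2" by (smt (verit) zero_le_power2)
  define q where "q = sqrt (1 + w\<^sup>2 + u\<^sup>2)"
  have q: "0 < q" "q\<^sup>2 = 1 + w\<^sup>2 + u\<^sup>2" using pos by (auto simp: q_def)
  have "((\<lambda>w. w / sqrt (1 + w\<^sup>2 + u\<^sup>2)) has_real_derivative (q - w * (w / q)) / (q * q)) (at w)"
    using DERIV_divide[OF DERIV_ident has_real_derivative_energy[of u w]] q(1) by (simp add: q_def)
  \<comment> \<open>The numerator becomes \<open>q\<^sup>2 - w\<^sup>2 = 1 + u\<^sup>2\<close>,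
    which shows the velocity to be increasing in \<open>w\<close>.\<close>
  moreover have "(q - w * (w / q)) / (q * q) = (1 + u\<^sup>2) / q ^ 3"
  proof -
    have "(q - w * (w / q)) / (q * q) = (q\<^sup>2 - w\<^sup>2) / q ^ 3"
      using q(1) by (simp add: field_simps power2_eq_square power3_eq_cube)
    then show ?thesis using q(2) by simp
  qed
  ultimately show ?thesis
    by (simp add: vhat1_def[abs_def] norm_prod_def q_def add.assoc)
qed

lemma vhat1_deriv_bounds:
  fixes u w :: real
  shows "0 \<le> (1 + u\<^sup>2) / sqrt (1 + w\<^sup>2 + u\<^sup>2) ^ 3" "(1 + u\<^sup>2) / sqrt (1 + w\<^sup>2 + u\<^sup>2) ^ 3 \<le> 1"
proof -
  define q where "q = sqrt (1 + w\<^sup>2 + u\<^sup>2)"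
  have q: "1 \<le> q" "q\<^sup>2 = 1 + w\<^sup>2 + u\<^sup>2" by (auto simp: q_def)
  show "0 \<le> (1 + u\<^sup>2) / sqrt (1 + w\<^sup>2 + u\<^sup>2) ^ 3" by simp
  have "1 + u\<^sup>2 \<le> q\<^sup>2" using q by simp
  also have "\<dots> \<le> q ^ 3" using q(1) by (intro power_increasing) auto
  finally show "(1 + u\<^sup>2) / sqrt (1 + w\<^sup>2 + u\<^sup>2) ^ 3 \<le> 1" using q(1) by (simp add: q_def[symmetric])
qed

text \<open>With \<open>q\<close> the energy, the second derivative is
  \<open>- 3 * w * (1 + u\<^sup>2) / q ^ 5\<close>; it is at most 3 in absolute value because
  \<open>\<bar>w\<bar> \<le> q\<close>, \<open>1 + u\<^sup>2 \<le> q\<^sup>2\<close> and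
  \<open>1 \<le> q\<close>.\<close>

lemma vhat1_deriv_lipschitz:
  fixes u y z :: real
  shows "\<bar>(1 + u\<^sup>2) / sqrt (1 + y\<^sup>2 + u\<^sup>2) ^ 3 - (1 + u\<^sup>2) / sqrt (1 + z\<^sup>2 + u\<^sup>2) ^ 3\<bar> \<le> 3 * \<bar>y - z\<bar>"
proof -
  define G where "G = (\<lambda>w. (1 + u\<^sup>2) / sqrt (1 + w\<^sup>2 + u\<^sup>2) ^ 3)"
  define G' where "G' = (\<lambda>w. - (3 * w * (1 + u\<^sup>2) / sqrt (1 + w\<^sup>2 + u\<^sup>2) ^ 5))"
  have der: "(G has_real_derivative G' w) (at w)" for w
  proof -
    have pos: "0 < 1 + w\<^sup>2 + u\<^sup>2" by (smt (verit) zero_le_power2)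
    define q where "q = sqrt (1 + w\<^sup>2 + u\<^sup>2)"
    have q: "0 < q" using pos by (auto simp: q_def)
    have "(G has_real_derivative - ((1 + u\<^sup>2) * (3 * q\<^sup>2 * (w / q))) / (q ^ 3 * q ^ 3)) (at w)"
      using DERIV_divide[OF DERIV_const[of "1 + u\<^sup>2"] DERIV_power[OF has_real_derivative_energy[of u w], of 3]] q
      unfolding G_def q_def by (simp add: mult_ac)
    moreover have "- ((1 + u\<^sup>2) * (3 * q\<^sup>2 * (w / q))) / (q ^ 3 * q ^ 3) = G' w"
      unfolding G'_def q_def[symmetric] using q by (simp add: divide_simps eval_nat_numeral)
    ultimately show ?thesis by simp
  qed
  have bound: "\<bar>G' w\<bar> \<le> 3" for w
  proof -
    define q where "q = sqrt (1 + w\<^sup>2 + u\<^sup>2)"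
    have q: "1 \<le> q" "q\<^sup>2 = 1 + w\<^sup>2 + u\<^sup>2" by (auto simp: q_def)
    have "\<bar>w\<bar> \<le> q" unfolding q_def by (rule real_le_rsqrt) (simp add: add.commute)
    then have "\<bar>w\<bar> * (1 + u\<^sup>2) \<le> q * q\<^sup>2" using q by (intro mult_mono) auto
    also have "\<dots> = q ^ 3" by (simp add: power2_eq_square power3_eq_cube)
    also have "\<dots> \<le> q ^ 5" using q(1) by (intro power_increasing) auto
    finally have "\<bar>w\<bar> * (1 + u\<^sup>2) / q ^ 5 \<le> 1" using q(1) by simp
    moreover have "\<bar>G' w\<bar> = 3 * (\<bar>w\<bar> * (1 + u\<^sup>2) / q ^ 5)"
      using q(1) by (simp add: G'_def q_def[symmetric] abs_mult)
    ultimately show ?thesis by simp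
  qed
  obtain \<xi> where "G y - G z = G' \<xi> * (y - z)" using mean_value_quotient[OF der] by metis
  then have "\<bar>G y - G z\<bar> \<le> 3 * \<bar>y - z\<bar>"
    using bound[of \<xi>] by (simp add: abs_mult mult_right_mono)
  then show ?thesis by (simp add: G_def)
qed

lemma abs_vhat1_le_1: "\<bar>vhat1 v\<bar> \<le> 1"
proof -
  have "\<bar>fst v\<bar> \<le> sqrt (1 + (norm v)\<^sup>2)"
    by (rule real_le_rsqrt) (simp add: norm_prod_def)
  moreover have "0 < sqrt (1 + (norm v)\<^sup>2)" by (smt (verit) real_sqrt_gt_zero zero_le_power2)
  ultimately show ?thesis by (simp add: vhat1_def)
qed

subsection \<open>Solutions and their characteristics\<close>

text \<open>A box instead of a compact set: one number \<open>B\<close> can then serve a whole time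
  interval.\<close>

definition support_bound :: "(real \<Rightarrow> real \<times> real \<Rightarrow> real) \<Rightarrow> real \<Rightarrow> bool" where
  "support_bound g B \<longleftrightarrow> (\<forall>x v. g x v \<noteq> 0 \<longrightarrow> \<bar>x\<bar> \<le> B \<and> \<bar>fst v\<bar> \<le> B \<and> \<bar>snd v\<bar> \<le> B)"

lemma support_bound_position: "support_bound g B \<Longrightarrow> B < \<bar>x\<bar> \<Longrightarrow> g x v = 0"
  unfolding support_bound_def by (meson not_le)

lemma support_bound_momentum:
  assumes "support_bound g B" "v \<notin> cbox (- B, - B) (B, B)"
  shows "g x v = 0"
proof (rule ccontr)
  assume "g x v \<noteq> 0"
  then have "\<bar>fst v\<bar> \<le> B" "\<bar>snd v\<bar> \<le> B" using assms(1) unfolding support_bound_def by blast+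
  then have "v \<in> cbox (- B, - B) (B, B)" by (cases v) (simp add: cbox_Pair_eq abs_le_iff)
  with assms(2) show False by simp
qed

lemma compactly_supported_bound:
  assumes "compactly_supported (\<lambda>(x, v). g x v)"
  obtains B where "support_bound g B"
proof -
  have "bounded {z. (case z of (x, v) \<Rightarrow> g x v) \<noteq> 0}"
    using assms bounded_subset[OF compact_imp_bounded closure_subset]
    by (auto simp: compactly_supported_def)
  then obtain B where B: "\<And>z. (case z of (x, v) \<Rightarrow> g x v) \<noteq> 0 \<Longrightarrow> norm z \<le> B"
    by (auto simp: bounded_iff)
  have "support_bound g B"
    unfolding support_bound_def
  proof (intro allI impI)
    fix x v assume "g x v \<noteq> 0"
    then have "norm (x, v) \<le> B" using B[of "(x, v)"] by simp
    moreover have "norm x \<le> norm (x, v)" "norm v \<le> norm (x, v)"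
      using norm_fst_le[of x v] norm_snd_le[of v x] by auto
    moreover have "norm (fst v) \<le> norm v" "norm (snd v) \<le> norm v"
      using norm_fst_le[of "fst v" "snd v"] norm_snd_le[of "snd v" "fst v"] by auto
    ultimately show "\<bar>x\<bar> \<le> B \<and> \<bar>fst v\<bar> \<le> B \<and> \<bar>snd v\<bar> \<le> B" by auto
  qed
  then show ?thesis by (rule that)
qed

locale vlasov_characteristics =
  fixes f0 :: "real \<Rightarrow> real \<times> real \<Rightarrow> real"
    and f :: "real \<Rightarrow> real \<Rightarrow> real \<times> real \<Rightarrow> real"
    and X :: "real \<Rightarrow> real \<Rightarrow> real \<Rightarrow> real \<times> real \<Rightarrow> real"
    and V :: "real \<Rightarrow> real \<Rightarrow> real \<Rightarrow> real \<times> real \<Rightarrow> real \<times> real"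
  assumes solution: "vlasov_poisson_solution f0 f"
    and chars: "characteristics f X V"
begin

lemma f_nonneg: "0 \<le> t \<Longrightarrow> 0 \<le> f t x v"
  using solution unfolding vlasov_poisson_solution_def by blast

lemma f_initial: "f 0 x v = f0 x v"
  using solution unfolding vlasov_poisson_solution_def by blast

lemma f_support: "0 \<le> t \<Longrightarrow> compactly_supported (\<lambda>(x, v). f t x v)"
  using solution unfolding vlasov_poisson_solution_def by blast

lemma X_end: "0 \<le> t \<Longrightarrow> X t t x v = x"
  and V1_end: "0 \<le> t \<Longrightarrow> fst (V t t x v) = fst v"
  and V2: "0 \<le> t \<Longrightarrow> 0 \<le> s \<Longrightarrow> snd (V s t x v) = snd v"
  and X_deriv: "0 \<le> t \<Longrightarrow> 0 \<le> s \<Longrightarrow>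
    ((\<lambda>r. X r t x v) has_real_derivative vhat1 (V s t x v)) (at s within {0..})"
  and V1_deriv: "0 \<le> t \<Longrightarrow> 0 \<le> s \<Longrightarrow>
    ((\<lambda>r. fst (V r t x v)) has_real_derivative E1 f s (X s t x v)) (at s within {0..})"
  using chars unfolding characteristics_def by blast+

lemma V_end: "0 \<le> t \<Longrightarrow> V t t x v = v"
  by (simp add: prod_eq_iff V1_end V2)

section \<open>The solution along its characteristics\<close>

lemma f_derivative:
  obtains f' where "\<And>z. z \<in> {0..} \<times> UNIV \<Longrightarrow>
      ((\<lambda>(t, x, v). f t x v) has_derivative blinfun_apply (f' z)) (at z within {0..} \<times> UNIV)"
    and "continuous_on ({0..} \<times> UNIV) f'"
proof -
  have "C1_on (\<lambda>(t, x, v). f t x v) ({0..} \<times> UNIV)"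
    using solution unfolding vlasov_poisson_solution_def by (rule conjunct1)
  then obtain f' where 1: "\<forall>z\<in>{0..} \<times> UNIV.
      ((\<lambda>(t, x, v). f t x v) has_derivative blinfun_apply (f' z)) (at z within {0..} \<times> UNIV)"
    and 2: "continuous_on ({0..} \<times> UNIV) f'"
    unfolding C1_on_def by (elim exE conjE)
  show ?thesis by (rule that[OF _ 2]) (rule bspec[OF 1])
qed

text \<open>Chain rule on the closed half space of times. On coordinate lines it yields the partial
  derivatives, on characteristics the transport derivative.\<close>

lemma f_along_curve:
  assumes D: "((\<lambda>(t, x, v). f t x v) has_derivative D) (at (c s) within {0..} \<times> UNIV)"
    and c: "(c has_vector_derivative u) (at s within S)" and "c ` S \<subseteq> {0..} \<times> UNIV"
  shows "((\<lambda>r. f (fst (c r)) (fst (snd (c r))) (snd (snd (c r)))) has_real_derivative D u) (at s within S)"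
  using vector_derivative_diff_chain_within[OF c has_derivative_subset[OF D assms(3)]]
  by (simp only: has_real_derivative_iff_has_vector_derivative o_def case_prod_beta)

lemma f_x_derivative:
  assumes D: "((\<lambda>(t, x, v). f t x v) has_derivative D) (at (t, x, v) within {0..} \<times> UNIV)" and "0 \<le> t"
  shows "((\<lambda>y. f t y v) has_real_derivative D (0, 1, 0)) (at x)"
proof -
  have "((\<lambda>y. (t, y, v)) has_vector_derivative (0, 1, 0)) (at x)"
    by (intro has_vector_derivative_Pair has_vector_derivative_const has_vector_derivative_id)
  from f_along_curve[OF D this] show ?thesis using \<open>0 \<le> t\<close> by auto
qed

text \<open>The Vlasov equation speaks of partial derivatives. By uniqueness they are the values of
  the total derivative \<open>D\<close> in the coordinate directions, and linearity of
  \<open>D\<close> assembles them into the derivative in the direction of the phase space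
  velocity.\<close>

lemma f_derivative_along_flow:
  assumes D: "((\<lambda>(t, x, v). f t x v) has_derivative D) (at (t, x, v) within {0..} \<times> UNIV)" and "0 \<le> t"
  shows "D (1, vhat1 v, (E1 f t x, 0)) = 0"
proof -
  obtain ft fx fv where
    ft: "((\<lambda>s. f s x v) has_real_derivative ft) (at t within {0..})" and
    fx: "((\<lambda>y. f t y v) has_real_derivative fx) (at x)" and
    fv: "((\<lambda>w. f t x (w, snd v)) has_real_derivative fv) (at (fst v))" and
    eq: "ft + vhat1 v * fx + E1 f t x * fv = 0"
    using solution \<open>0 \<le> t\<close> unfolding vlasov_poisson_solution_def vlasov_equation_at_def by meson
  have "((\<lambda>s. (s, x, v)) has_vector_derivative (1, 0, 0)) (at t within {0..})"
    by (intro has_vector_derivative_Pair has_vector_derivative_const has_vector_derivative_id)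
  from f_along_curve[OF D this] have "((\<lambda>s. f s x v) has_real_derivative D (1, 0, 0)) (at t within {0..})"
    by auto
  then have 1: "D (1, 0, 0) = ft"
    using ft \<open>0 \<le> t\<close> by (rule has_real_derivative_within_atLeast_unique)
  have 2: "D (0, 1, 0) = fx"
    using DERIV_unique[OF f_x_derivative[OF assms] fx] .
  have c: "((\<lambda>w. (t, x, (w, snd v))) has_vector_derivative (0, 0, (1, 0))) (at (fst v))"
    by (intro has_vector_derivative_Pair has_vector_derivative_const has_vector_derivative_id)
  have "((\<lambda>w. f t x (w, snd v)) has_real_derivative D (0, 0, (1, 0))) (at (fst v))"
    using f_along_curve[OF _ c, of D] D \<open>0 \<le> t\<close> by auto
  then have 3: "D (0, 0, (1, 0)) = fv" using DERIV_unique fv by blast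
  note lin = linear_add[OF has_derivative_linear[OF D]] linear_cmul[OF has_derivative_linear[OF D]]
  have "(1, vhat1 v, (E1 f t x, 0)) = (1, 0, 0) + (vhat1 v *\<^sub>R (0, 1, 0) + E1 f t x *\<^sub>R (0 :: real, 0, (1, 0 :: real)))"
    by (simp add: zero_prod_def)
  then have "D (1, vhat1 v, (E1 f t x, 0))
      = D (1, 0, 0) + (vhat1 v *\<^sub>R D (0, 1, 0) + E1 f t x *\<^sub>R D (0, 0, (1, 0)))"
    by (simp only: lin)
  then show ?thesis using eq 1 2 3 by simp
qed

lemma f_along_characteristics:
  assumes "0 \<le> t" "0 \<le> s"
  shows "f s (X s t x v) (V s t x v) = f t x v"
proof -
  let ?c = "\<lambda>r. (r, X r t x v, V r t x v)"
  obtain f' where f': "\<And>z. z \<in> {0..} \<times> UNIV \<Longrightarrow>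
      ((\<lambda>(t, x, v). f t x v) has_derivative blinfun_apply (f' z)) (at z within {0..} \<times> UNIV)"
    using f_derivative by blast
  have "((\<lambda>r. f r (X r t x v) (V r t x v)) has_derivative (\<lambda>h. 0)) (at r within {0..})" if "r \<in> {0..}" for r
  proof -
    have r: "0 \<le> r" using that by simp
    \<comment> \<open>The second momentum component is conserved; written as the constant
      \<open>snd v\<close> it contributes derivative 0.\<close>
    have "((\<lambda>r. (r, X r t x v, (fst (V r t x v), snd v))) has_vector_derivative
        (1, vhat1 (V r t x v), (E1 f r (X r t x v), 0))) (at r within {0..})"
      using X_deriv[OF assms(1) r, of x v] V1_deriv[OF assms(1) r, of x v]
      unfolding has_real_derivative_iff_has_vector_derivative
      by (intro has_vector_derivative_Pair has_vector_derivative_const has_vector_derivative_id)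
    then have c: "(?c has_vector_derivative (1, vhat1 (V r t x v), (E1 f r (X r t x v), 0))) (at r within {0..})"
      by (rule has_vector_derivative_transform[OF that, rotated]) (use V2[OF assms(1)] in \<open>auto simp: prod_eq_iff\<close>)
    have D: "((\<lambda>(t, x, v). f t x v) has_derivative f' (?c r)) (at (?c r) within {0..} \<times> UNIV)"
      using f'[of "?c r"] r by simp
    have "?c ` {0..} \<subseteq> {0..} \<times> UNIV" by auto
    from f_along_curve[OF D c this] f_derivative_along_flow[OF D r]
    show ?thesis by (simp add: has_field_derivative_def lambda_zero)
  qed
  then obtain c where "\<And>r. r \<in> {0..} \<Longrightarrow> f r (X r t x v) (V r t x v) = c"
    using has_derivative_zero_constant[of "{0..}" "\<lambda>r. f r (X r t x v) (V r t x v)"] by auto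
  from this[of s] this[of t] assms show ?thesis by (simp add: X_end V_end)
qed

lemma f_eq_initial: "0 \<le> t \<Longrightarrow> f t x v = f0 (X 0 t x v) (V 0 t x v)"
  using f_along_characteristics[of t 0 x v] by (simp add: f_initial)

text \<open>Finite propagation speed: as \<open>vhat1\<close> has modulus at most 1, time minus
  position and time plus position are both nondecreasing.\<close>

lemma X_speed:
  assumes "0 \<le> t" "0 \<le> r" "r \<le> s"
  shows "\<bar>X s t x v - X r t x v\<bar> \<le> s - r"
proof -
  have S: "{r..s} \<subseteq> {0..}" using assms by auto
  note X = X_deriv[OF assms(1), where x = x and v = v]
  have "r - X r t x v \<le> s - X s t x v"
  proof (rule has_real_derivative_nonneg_imp_le[OF assms(3) S])
    fix q assume "q \<in> {r..s}"
    then show "((\<lambda>r. r - X r t x v) has_real_derivative 1 - vhat1 (V q t x v)) (at q within {0..})"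
      using assms by (intro derivative_intros X) auto
  qed (use abs_vhat1_le_1 in \<open>auto simp: abs_le_iff\<close>)
  moreover have "r + X r t x v \<le> s + X s t x v"
  proof (rule has_real_derivative_nonneg_imp_le[OF assms(3) S])
    fix q assume "q \<in> {r..s}"
    then show "((\<lambda>r. r + X r t x v) has_real_derivative 1 + vhat1 (V q t x v)) (at q within {0..})"
      using assms by (intro derivative_intros X) auto
    show "0 \<le> 1 + vhat1 (V q t x v)"
      using abs_vhat1_le_1[of "V q t x v"] by (simp add: abs_le_iff)
  qed
  ultimately show ?thesis by (simp add: abs_le_iff)
qed

text \<open>The derivative of \<open>f\<close> is continuous, hence bounded, on the compact box of
  times, positions and momenta given by the support bound; off the box the position derivative is
  0.\<close>

lemma f_lipschitz_x:
  assumes "0 \<le> a" and supp: "\<And>t. t \<in> {a..b} \<Longrightarrow> support_bound (f t) B"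
  obtains L where "0 \<le> L" "\<And>t x y v. t \<in> {a..b} \<Longrightarrow> \<bar>f t x v - f t y v\<bar> \<le> L * \<bar>x - y\<bar>"
proof -
  let ?K = "{a..b} \<times> {-B..B} \<times> cbox (-B, -B) (B, B)"
  obtain f' where f': "\<And>z. z \<in> {0..} \<times> UNIV \<Longrightarrow>
      ((\<lambda>(t, x, v). f t x v) has_derivative blinfun_apply (f' z)) (at z within {0..} \<times> UNIV)"
    and cont: "continuous_on ({0..} \<times> UNIV) f'"
    using f_derivative by blast
  have "compact ?K" by (intro compact_Times compact_cbox compact_Icc)
  moreover have "continuous_on ?K f'"
    by (rule continuous_on_subset[OF cont]) (use \<open>0 \<le> a\<close> in auto)
  ultimately have "bounded (f' ` ?K)" by (intro compact_imp_bounded compact_continuous_image)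
  then obtain L where L: "0 < L" "\<And>z. z \<in> ?K \<Longrightarrow> norm (f' z) \<le> L"
    unfolding bounded_pos by blast
  have "\<bar>f t x v - f t y v\<bar> \<le> L * \<bar>x - y\<bar>" if t: "t \<in> {a..b}" for t x y v
  proof -
    let ?d = "\<lambda>x. f' (t, x, v) (0, 1, 0)"
    have t0: "0 \<le> t" using t \<open>0 \<le> a\<close> by simp
    have der: "((\<lambda>y. f t y v) has_real_derivative ?d x) (at x)" for x
      using f_x_derivative[OF f' t0] t0 by simp
    have bound: "\<bar>?d x\<bar> \<le> L" for x
    proof (cases "(t, x, v) \<in> ?K")
      case True
      have "norm (?d x) \<le> norm (f' (t, x, v)) * norm ((0, 1, 0) :: real \<times> real \<times> real \<times> real)"
        by (rule norm_blinfun)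
      also have "\<dots> \<le> L" using L(2)[OF True] by (simp add: norm_prod_def)
      finally show ?thesis by simp
    next
      case False
      \<comment> \<open>Off the box, either the position exceeds \<open>B\<close> in modulus, an
        open condition, or the momentum lies outside its box, and then \<open>f\<close> vanishes at
        every position.\<close>
      have "\<exists>U. open U \<and> x \<in> U \<and> (\<forall>y\<in>U. f t y v = 0)"
      proof (cases "v \<in> cbox (-B, -B) (B, B)")
        case True
        with False t have "B < \<bar>x\<bar>" by auto
        moreover have "open {y::real. B < \<bar>y\<bar>}" by (intro open_Collect_less continuous_intros)
        moreover have "\<forall>y\<in>{y. B < \<bar>y\<bar>}. f t y v = 0" using support_bound_position[OF supp[OF t]] by simp
        ultimately show ?thesis by blast
      next
        case False
        then show ?thesis
          using support_bound_momentum[OF supp[OF t]] by (intro exI[of _ UNIV]) auto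
      qed
      then obtain U where U: "open U" "x \<in> U" "\<And>y. y \<in> U \<Longrightarrow> f t y v = 0" by blast
      have "((\<lambda>y. f t y v) has_real_derivative 0) (at x)"
        using U DERIV_const[of 0]
        by (rule_tac has_field_derivative_transform_within_open[OF DERIV_const[of 0] U(1,2)]) auto
      then have "?d x = 0" using DERIV_unique[OF der] by blast
      then show ?thesis using L(1) by simp
    qed
    obtain \<xi> where "f t x v - f t y v = ?d \<xi> * (x - y)"
      using mean_value_quotient[of "\<lambda>y. f t y v" ?d x y] der by metis
    then show ?thesis using bound[of \<xi>] by (simp add: abs_mult mult_right_mono)
  qed
  then show ?thesis using that[of L] L(1) by simp
qed

lemma continuous_f_v:
  assumes "0 \<le> t"
  shows "continuous_on UNIV (f t x)"
proof -
  have "continuous_on ({0..} \<times> UNIV) (\<lambda>(t, x, v). f t x v)"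
    using f_derivative has_derivative_continuous
    by (metis continuous_on_eq_continuous_within)
  then have "continuous_on UNIV (\<lambda>v. (\<lambda>(t, x, v). f t x v) (t, x, v))"
    by (rule continuous_on_compose2) (use assms in \<open>auto intro!: continuous_intros\<close>)
  then show ?thesis by simp
qed

section \<open>Charge density and field of the solution\<close>

lemma charge_density_nonneg: "0 \<le> t \<Longrightarrow> 0 \<le> charge_density f t x"
  unfolding charge_density_def by (rule Bochner_Integration.integral_nonneg) (rule f_nonneg)

lemma charge_density_support:
  assumes "support_bound (f t) B" "B < \<bar>x\<bar>"
  shows "charge_density f t x = 0"
  using support_bound_position[OF assms] by (simp add: charge_density_def)

text \<open>Used twice: with the interval \<open>{t..t}\<close> to make each time slice a
  \<open>compact_density\<close>, and with \<open>{0..T}\<close> once supports are known to be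
  uniform. The field estimates proved from the first use lead to that uniformity.\<close>

lemma charge_density_lipschitz:
  assumes "0 \<le> a" "\<And>t. t \<in> {a..b} \<Longrightarrow> support_bound (f t) B"
  obtains L where "0 \<le> L"
    "\<And>t x y. t \<in> {a..b} \<Longrightarrow> \<bar>charge_density f t x - charge_density f t y\<bar> \<le> L * \<bar>x - y\<bar>"
proof -
  let ?K = "cbox (-B, -B) (B, B) :: (real \<times> real) set"
  obtain L where L: "0 \<le> L" "\<And>t x y v. t \<in> {a..b} \<Longrightarrow> \<bar>f t x v - f t y v\<bar> \<le> L * \<bar>x - y\<bar>"
    using f_lipschitz_x[OF assms] by metis
  have "\<bar>charge_density f t x - charge_density f t y\<bar> \<le> L * measure lborel ?K * \<bar>x - y\<bar>"
    if t: "t \<in> {a..b}" for t x y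
    unfolding charge_density_def
    using t \<open>0 \<le> a\<close> continuous_f_v support_bound_momentum[OF assms(2)[OF t]] L(2)[OF t]
    by (intro velocity_integral_lipschitz) auto
  then show ?thesis using that[of "L * measure lborel ?K"] L(1) by simp
qed

lemma compact_density:
  assumes "0 \<le> t" "support_bound (f t) B"
  shows "compact_density (charge_density f t) B"
proof
  have "support_bound (f s) B" if "s \<in> {t..t}" for s using that assms(2) by simp
  from charge_density_lipschitz[OF assms(1) this]
  obtain L where L: "\<And>s x y. s \<in> {t..t} \<Longrightarrow> \<bar>charge_density f s x - charge_density f s y\<bar> \<le> L * \<bar>x - y\<bar>"
      "0 \<le> L"
    by metis
  show "continuous_on UNIV (charge_density f t)"
    by (rule lipschitz_on_continuous_on[of L]) (use L in \<open>auto intro!: lipschitz_onI simp: dist_real_def\<close>)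
  show "0 \<le> charge_density f t x" for x using assms(1) by (rule charge_density_nonneg)
  show "charge_density f t x = 0" if "B < \<bar>x\<bar>" for x using assms(2) that by (rule charge_density_support)
qed

lemma E1_eq_field: "E1 f t = compact_density.field (charge_density f t)"
  if "0 \<le> t" "support_bound (f t) B"
  by (intro ext) (simp only: compact_density.field_def[OF compact_density[OF that]] E1_def)

definition total_charge :: "real \<Rightarrow> real" where
  "total_charge t = (LINT y|lborel. charge_density f t y)"

lemma ex_compact_density:
  assumes "0 \<le> t"
  obtains B where "compact_density (charge_density f t) B" "E1 f t = compact_density.field (charge_density f t)"
    "total_charge t = compact_density.mass (charge_density f t)"
proof -
  obtain B where B: "support_bound (f t) B"
    using compactly_supported_bound[OF f_support[OF assms]] by blast
  show ?thesis
    using that compact_density[OF assms B] E1_eq_field[OF assms B]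
    by (simp add: total_charge_def compact_density.mass_def)
qed

lemma E1_deriv: "0 \<le> t \<Longrightarrow> (E1 f t has_real_derivative charge_density f t x) (at x)"
  using ex_compact_density compact_density.field_deriv by metis

lemma abs_E1_le: "0 \<le> t \<Longrightarrow> \<bar>E1 f t x\<bar> \<le> total_charge t / 2"
  using ex_compact_density compact_density.abs_field_le by metis

lemma E1_right:
  assumes "0 \<le> t" "\<And>y v. x < y \<Longrightarrow> f t y v = 0"
  shows "E1 f t x = total_charge t / 2"
proof -
  have "charge_density f t y = 0" if "x < y" for y
    using assms(2)[OF that] by (simp add: charge_density_def)
  then show ?thesis
    using ex_compact_density[OF assms(1)] compact_density.field_right by metis
qed

section \<open>Uniform supports on bounded time intervals\<close>

lemma support_bound_initial:
  obtains R where "support_bound f0 R"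
proof -
  have "f 0 = f0" by (intro ext) (rule f_initial)
  then show ?thesis using compactly_supported_bound[OF f_support[of 0]] that by auto
qed

text \<open>A characteristic through a point where \<open>f\<close> is nonzero starts in the support
  of \<open>f0\<close>. Position spreads with speed at most 1 and the second momentum is conserved;
  the first momentum is bounded here only at time 0, its growth being the subject of
  \<open>V1_drift\<close>.\<close>

lemma support_back:
  assumes "support_bound f0 R" "0 \<le> t" "f t x v \<noteq> 0"
  shows "\<bar>x\<bar> \<le> R + t" "\<bar>snd v\<bar> \<le> R" "\<bar>fst (V 0 t x v)\<bar> \<le> R"
proof -
  have "f0 (X 0 t x v) (V 0 t x v) \<noteq> 0" using assms f_eq_initial by simp
  then have "\<bar>X 0 t x v\<bar> \<le> R" and V0: "\<bar>fst (V 0 t x v)\<bar> \<le> R" "\<bar>snd (V 0 t x v)\<bar> \<le> R"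
    using assms(1) unfolding support_bound_def by blast+
  then show "\<bar>x\<bar> \<le> R + t"
    using X_speed[OF assms(2) order_refl assms(2), of x v] X_end[OF assms(2), of x v] by linarith
  show "\<bar>fst (V 0 t x v)\<bar> \<le> R" by fact
  show "\<bar>snd v\<bar> \<le> R" using V0(2) assms(2) by (simp add: V2)
qed

text \<open>
  No uniformity in time of the supports is assumed. The momentum of a test particle travelling
  to the right of all the charge has derivative \<open>total_charge s / 2\<close>, which dominates the
  field, so its finite increment bounds every other change of momentum.
\<close>

lemma V1_drift:
  assumes "0 \<le> T"
  obtains G where "\<And>t x v. t \<in> {0..T} \<Longrightarrow> \<bar>fst v - fst (V 0 t x v)\<bar> \<le> G"
proof -
  obtain R where R: "support_bound f0 R" by (rule support_bound_initial)
  \<comment> \<open>Up to time \<open>T\<close> the charge stays within \<open>R + T\<close> of the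
    origin, and the test particle moves by at most \<open>T\<close>, so no charge ever lies to its
    right.\<close>
  define x0 where "x0 = R + 2 * T"
  define g where "g = (\<lambda>s. fst (V s 0 x0 0))"
  have g: "(g has_real_derivative total_charge s / 2) (at s within {0..})" if s: "s \<in> {0..T}" for s
  proof -
    have "f s y v = 0" if "X s 0 x0 0 < y" for y v
    proof (rule ccontr)
      assume "f s y v \<noteq> 0"
      then have "\<bar>y\<bar> \<le> R + s" using support_back(1)[OF R] s by simp
      moreover have "\<bar>X s 0 x0 0 - x0\<bar> \<le> s"
        using X_speed[of 0 0 s x0 0] X_end[of 0 x0 0] s by simp
      moreover have "s \<le> T" using s by simp
      ultimately show False using that unfolding x0_def by linarith
    qed
    then have "E1 f s (X s 0 x0 0) = total_charge s / 2" using E1_right[of s] s by auto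
    then show ?thesis using V1_deriv[of 0 s x0 0] s unfolding g_def by (metis atLeastAtMost_iff order_refl)
  qed
  have "\<bar>fst v - fst (V 0 t x v)\<bar> \<le> g T - g 0" if t: "t \<in> {0..T}" for t x v
  proof -
    have t0: "0 \<le> t" and S: "{0..t} \<subseteq> {0..}" using t by auto
    have "g 0 - fst (V 0 t x v) \<le> g t - fst (V t t x v)"
    proof (rule has_real_derivative_nonneg_imp_le[OF t0 S, where g = "\<lambda>s. g s - fst (V s t x v)"])
      fix s assume s: "s \<in> {0..t}"
      show "((\<lambda>s. g s - fst (V s t x v)) has_real_derivative total_charge s / 2 - E1 f s (X s t x v))
          (at s within {0..})"
        using s t by (intro DERIV_diff g V1_deriv) auto
      show "0 \<le> total_charge s / 2 - E1 f s (X s t x v)"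
        using abs_E1_le[of s "X s t x v"] s by simp
    qed
    moreover have "g 0 + fst (V 0 t x v) \<le> g t + fst (V t t x v)"
    proof (rule has_real_derivative_nonneg_imp_le[OF t0 S, where g = "\<lambda>s. g s + fst (V s t x v)"])
      fix s assume s: "s \<in> {0..t}"
      show "((\<lambda>s. g s + fst (V s t x v)) has_real_derivative total_charge s / 2 + E1 f s (X s t x v))
          (at s within {0..})"
        using s t by (intro DERIV_add g V1_deriv) auto
      show "0 \<le> total_charge s / 2 + E1 f s (X s t x v)"
        using abs_E1_le[of s "X s t x v"] s by simp
    qed
    \<comment> \<open>Passing from \<open>t\<close> to \<open>T\<close> makes the bound uniform in
      \<open>t\<close>.\<close>
    moreover have "g t \<le> g T"
    proof (rule has_real_derivative_nonneg_imp_le[where g = g])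
      show "t \<le> T" "{t..T} \<subseteq> {0..}" using t by auto
      fix s assume s: "s \<in> {t..T}"
      then show "(g has_real_derivative total_charge s / 2) (at s within {0..})"
        using t by (intro g) auto
      show "0 \<le> total_charge s / 2" using abs_E1_le[of s 0] s t by simp
    qed
    ultimately show ?thesis using V1_end[OF t0, of x v] by simp
  qed
  then show ?thesis by (rule that)
qed

lemma locally_uniform_support:
  assumes "0 \<le> T"
  obtains B where "\<And>t. t \<in> {0..T} \<Longrightarrow> support_bound (f t) B"
proof -
  obtain R where R: "support_bound f0 R" by (rule support_bound_initial)
  obtain G where G: "\<And>t x v. t \<in> {0..T} \<Longrightarrow> \<bar>fst v - fst (V 0 t x v)\<bar> \<le> G"
    using V1_drift[OF assms] by blast
  have "support_bound (f t) (R + T + G)" if t: "t \<in> {0..T}" for t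
    unfolding support_bound_def
  proof (intro allI impI)
    fix x v assume "f t x v \<noteq> 0"
    then have "\<bar>x\<bar> \<le> R + t" "\<bar>snd v\<bar> \<le> R" "\<bar>fst (V 0 t x v)\<bar> \<le> R"
      using support_back[OF R, of t x v] t by simp_all
    moreover have "0 \<le> t" "t \<le> T" using t by auto
    ultimately show "\<bar>x\<bar> \<le> R + T + G \<and> \<bar>fst v\<bar> \<le> R + T + G \<and> \<bar>snd v\<bar> \<le> R + T + G"
      using G[OF t, of v x] assms by linarith
  qed
  then show ?thesis by (rule that)
qed

lemma charge_density_bounds:
  assumes "0 \<le> T"
  obtains L where "\<And>t x. t \<in> {0..T} \<Longrightarrow> charge_density f t x \<le> L"
    "\<And>t x y. t \<in> {0..T} \<Longrightarrow> \<bar>charge_density f t x - charge_density f t y\<bar> \<le> L * \<bar>x - y\<bar>"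
proof -
  obtain B where B: "\<And>t. t \<in> {0..T} \<Longrightarrow> support_bound (f t) B"
    using locally_uniform_support[OF assms] by blast
  obtain L where L: "0 \<le> L"
    "\<And>t x y. t \<in> {0..T} \<Longrightarrow> \<bar>charge_density f t x - charge_density f t y\<bar> \<le> L * \<bar>x - y\<bar>"
    using charge_density_lipschitz[OF order_refl B] by blast
  \<comment> \<open>The density vanishes at \<open>\<bar>B\<bar> + 1\<close>, which is at distance
    at most \<open>1 + 2 * \<bar>B\<bar>\<close> from every point of the support, so the Lipschitz
    bound becomes a bound on the density. As \<open>L \<le> K\<close>, the same constant serves as
    Lipschitz constant.\<close>
  define K where "K = L * (1 + 2 * \<bar>B\<bar>)"
  have "L * 1 \<le> K" unfolding K_def using L(1) by (intro mult_left_mono) auto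
  have "charge_density f t x \<le> K" if t: "t \<in> {0..T}" for t x
  proof (cases "B < \<bar>x\<bar>")
    case True
    then show ?thesis using charge_density_support[OF B[OF t]] L(1) by (simp add: K_def)
  next
    case False
    have "charge_density f t (\<bar>B\<bar> + 1) = 0"
      by (rule charge_density_support[OF B[OF t]]) simp
    then have "charge_density f t x \<le> L * \<bar>x - (\<bar>B\<bar> + 1)\<bar>"
      using L(2)[OF t, of x "\<bar>B\<bar> + 1"] by simp
    also have "\<dots> \<le> K" unfolding K_def using L(1) False by (intro mult_left_mono) auto
    finally show ?thesis .
  qed
  moreover have "\<bar>charge_density f t x - charge_density f t y\<bar> \<le> K * \<bar>x - y\<bar>" if "t \<in> {0..T}" for t x y
    using L(2)[OF that, of x y] mult_right_mono[OF \<open>L * 1 \<le> K\<close>, of "\<bar>x - y\<bar>"] by simp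
  ultimately show ?thesis by (rule that)
qed

section \<open>The derivative of the backward flow in the final momentum\<close>

lemma V1_deriv_ge_1:
  assumes "0 \<le> s" "s \<le> t"
  obtains D where "((\<lambda>w. fst (V s t x (w, u))) has_real_derivative D) (at w)" "1 \<le> D"
proof -
  have t: "0 \<le> t" using assms by simp
  obtain L where L: "\<And>s x. s \<in> {0..t} \<Longrightarrow> charge_density f s x \<le> L"
    "\<And>s x y. s \<in> {0..t} \<Longrightarrow> \<bar>charge_density f s x - charge_density f s y\<bar> \<le> L * \<bar>x - y\<bar>"
    using charge_density_bounds[OF t] by blast
  \<comment> \<open>Final position \<open>x\<close> and second momentum \<open>u\<close> are frozen;
    the slope of the field \<open>E1 f\<close> is the charge density. The 3 in
    \<open>max L 3\<close> covers the slope of the velocity and its Lipschitz constant.\<close>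
  interpret monotone_flow "\<lambda>w. vhat1 (w, u)" "\<lambda>w. (1 + u\<^sup>2) / sqrt (1 + w\<^sup>2 + u\<^sup>2) ^ 3"
    "E1 f" "charge_density f" "\<lambda>w s. X s t x (w, u)" "\<lambda>w s. fst (V s t x (w, u))" t "max L 3" w "{0..}"
  proof
    show "\<And>z. ((\<lambda>w. vhat1 (w, u)) has_real_derivative (1 + u\<^sup>2) / sqrt (1 + z\<^sup>2 + u\<^sup>2) ^ 3) (at z)"
      by (rule has_real_derivative_vhat1)
    show "0 \<le> (1 + u\<^sup>2) / sqrt (1 + z\<^sup>2 + u\<^sup>2) ^ 3" for z by (rule vhat1_deriv_bounds)
    show "(1 + u\<^sup>2) / sqrt (1 + z\<^sup>2 + u\<^sup>2) ^ 3 \<le> max L 3" for z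
      using vhat1_deriv_bounds(2)[of u z] by simp
    show "\<bar>(1 + u\<^sup>2) / sqrt (1 + y\<^sup>2 + u\<^sup>2) ^ 3 - (1 + u\<^sup>2) / sqrt (1 + z\<^sup>2 + u\<^sup>2) ^ 3\<bar> \<le> max L 3 * \<bar>y - z\<bar>" for y z
      by (rule order_trans[OF vhat1_deriv_lipschitz]) (simp add: mult_right_mono)
    fix s assume s: "s \<in> {0..t}"
    then have s0: "0 \<le> s" by simp
    show "(E1 f s has_real_derivative charge_density f s z) (at z)" for z by (rule E1_deriv[OF s0])
    show "0 \<le> charge_density f s z" for z by (rule charge_density_nonneg[OF s0])
    show "charge_density f s z \<le> max L 3" for z using L(1)[OF s, of z] by simp
    show "\<bar>charge_density f s y - charge_density f s z\<bar> \<le> max L 3 * \<bar>y - z\<bar>" for y z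
      by (rule order_trans[OF L(2)[OF s]]) (simp add: mult_right_mono)
    have "(fst (V s t x (w, u)), u) = V s t x (w, u)" for w
      using V2[OF t s0, of x "(w, u)"] by (simp add: prod_eq_iff)
    then show "((\<lambda>s. X s t x (w, u)) has_real_derivative vhat1 (fst (V s t x (w, u)), u)) (at s within {0..})" for w
      using X_deriv[OF t s0] by simp
    show "((\<lambda>s. fst (V s t x (w, u))) has_real_derivative E1 f s (X s t x (w, u))) (at s within {0..})" for w
      by (rule V1_deriv[OF t s0])
  qed (use t in \<open>auto simp: X_end V1_end\<close>)
  show ?thesis using v_deriv_ge_1[of s] assms that by auto
qed

end

section \<open>Integration over momenta\<close>

text \<open>Inserting the factor \<open>\<phi>' \<ge> 1\<close> can only increase the integral of
  \<open>h (\<phi> w)\<close>, and then the change of variables gives the integral of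
  \<open>h\<close> over the range of \<open>\<phi>\<close>, at most the full integral as
  \<open>h \<ge> 0\<close>. The version used asks only for injectivity and pointwise
  differentiability, which is what the flow provides.\<close>

lemma integral_expanding_substitution:
  fixes h k \<phi> :: "real \<Rightarrow> real"
  assumes der: "\<And>w. (\<phi> has_real_derivative \<phi>' w) (at w)" and ge_1: "\<And>w. 1 \<le> \<phi>' w"
    and h: "integrable lborel h" "\<And>u. 0 \<le> h u"
    and k: "integrable lborel k" "\<And>w. k w \<le> h (\<phi> w)"
  shows "(LINT w|lborel. k w) \<le> (LINT u|lborel. h u)"
proof -
  have "\<phi> a < \<phi> b" if "a < b" for a b
    using DERIV_pos_imp_increasing[OF that] der ge_1 by (meson less_le_trans zero_less_one)
  then have inj: "inj \<phi>" by (intro linorder_injI) (metis less_irrefl)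
  have h_abs: "h absolutely_integrable_on UNIV"
    using h by (simp add: absolutely_integrable_on_iff_nonneg integrable_on_lborel)
  have "\<phi> ` UNIV \<in> sets lebesgue"
  proof (rule differentiable_image_in_sets_lebesgue)
    show "\<phi> differentiable_on UNIV"
      using der by (auto simp: differentiable_on_def intro: differentiableI[OF has_field_derivative_imp_has_derivative])
  qed auto
  then have h_range: "h absolutely_integrable_on range \<phi>"
    by (rule set_integrable_subset[OF h_abs]) auto
  have sub: "(\<lambda>w. \<bar>\<phi>' w\<bar> * h (\<phi> w)) absolutely_integrable_on UNIV"
    "integral UNIV (\<lambda>w. \<bar>\<phi>' w\<bar> * h (\<phi> w)) = integral (range \<phi>) h"
    using has_absolute_integral_change_of_variables_1'[of UNIV \<phi> \<phi>' h "integral (range \<phi>) h"] der inj h_range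
    by auto
  have "(LINT w|lborel. k w) = integral UNIV k" using k(1) by (simp add: integral_lborel)
  also have "\<dots> \<le> integral UNIV (\<lambda>w. \<bar>\<phi>' w\<bar> * h (\<phi> w))"
  proof (rule integral_le)
    show "k integrable_on UNIV" using k(1) by (rule integrable_on_lborel)
    show "(\<lambda>w. \<bar>\<phi>' w\<bar> * h (\<phi> w)) integrable_on UNIV"
      using sub(1) by (rule set_lebesgue_integral_eq_integral)
    show "k w \<le> \<bar>\<phi>' w\<bar> * h (\<phi> w)" for w
      using k(2)[of w] h(2)[of "\<phi> w"] ge_1[of w] mult_right_mono[of 1 "\<bar>\<phi>' w\<bar>" "h (\<phi> w)"] by simp
  qed
  also have "\<dots> = integral (range \<phi>) h" by (rule sub)
  also have "\<dots> \<le> integral UNIV h"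
    using h_abs h_range h(2) by (intro integral_subset_le) (auto simp: set_lebesgue_integral_eq_integral)
  also have "\<dots> = (LINT u|lborel. h u)" using h(1) by (simp add: integral_lborel)
  finally show ?thesis .
qed

text \<open>Superlevel sets of the supremum are unions of open sets, so even an uncountable family,
  such as that of all positions, has a Borel supremum.\<close>

lemma borel_measurable_SUP_continuous:
  fixes g :: "'i \<Rightarrow> 'a::topological_space \<Rightarrow> real"
  assumes "\<And>i. continuous_on UNIV (g i)" "\<And>v. bdd_above (range (\<lambda>i. g i v))"
  shows "(\<lambda>v. SUP i. g i v) \<in> borel_measurable borel"
  unfolding borel_measurable_iff_greater
proof (intro allI)
  fix c
  have "{v. c < (SUP i. g i v)} = (\<Union>i. {v. c < g i v})"
    using assms(2) by (auto simp: less_cSUP_iff)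
  moreover have "open (\<Union>i. {v. c < g i v})"
    by (intro open_UN ballI open_Collect_less continuous_intros assms(1))
  ultimately show "{v \<in> space borel. c < (SUP i. g i v)} \<in> sets borel" by simp
qed

context vlasov_characteristics
begin

text \<open>\<open>F0\<close> is merely Lebesgue integrable, so its slices may fail to be Borel
  measurable or integrable. The estimate therefore runs through the least majorant
  \<open>F1\<close>, the supremum of \<open>f0\<close> over positions, which is Borel, bounded and
  compactly supported; \<open>F0\<close> enters only through \<open>F1 \<le> F0\<close> at the
  end.\<close>

lemma charge_density_le:
  assumes t: "0 \<le> t" and F0: "integrable lebesgue F0" "\<And>x v. f0 x v \<le> F0 v"
  shows "charge_density f t x \<le> (LINT v|lebesgue. F0 v)"
proof -
  obtain B where B: "support_bound f0 B" by (rule support_bound_initial)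
  have f0_eq: "f 0 = f0" by (intro ext) (rule f_initial)
  have f0_nonneg: "0 \<le> f0 y v" for y v using f_nonneg[of 0 y v] by (simp add: f_initial)
  obtain L where L: "0 \<le> L" "\<And>y z v. \<bar>f0 y v - f0 z v\<bar> \<le> L * \<bar>y - z\<bar>"
  proof -
    have "support_bound (f s) B" if "s \<in> {0..0}" for s using that B f0_eq by simp
    from f_lipschitz_x[OF order_refl this] that show ?thesis
      unfolding f0_eq[symmetric] by (metis atLeastAtMost_singleton singletonI)
  qed
  \<comment> \<open>An upper bound for \<open>f0\<close>: it vanishes at position
    \<open>\<bar>B\<bar> + 1\<close>, at distance at most \<open>2 * \<bar>B\<bar> + 1\<close> from
    every position in the support.\<close>
  define C where "C = L * (2 * \<bar>B\<bar> + 1)"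
  have "0 \<le> C" using L(1) by (simp add: C_def)
  have f0_le: "f0 y v \<le> C" for y v
  proof (cases "f0 y v = 0")
    case False
    then have "\<bar>y\<bar> \<le> B" using B unfolding support_bound_def by blast
    have "f0 (\<bar>B\<bar> + 1) v = 0" by (rule support_bound_position[OF B]) simp
    then have "f0 y v \<le> L * \<bar>y - (\<bar>B\<bar> + 1)\<bar>" using L(2)[of y v "\<bar>B\<bar> + 1"] by simp
    also have "\<dots> \<le> C" unfolding C_def using L(1) \<open>\<bar>y\<bar> \<le> B\<close> by (intro mult_left_mono) auto
    finally show ?thesis .
  qed (simp add: \<open>0 \<le> C\<close>)
  have bdd: "bdd_above (range (\<lambda>y. f0 y v))" for v by (rule bdd_aboveI2[of _ _ C]) (rule f0_le)
  define F1 where "F1 = (\<lambda>v. SUP y. f0 y v)"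
  have F1_ge: "f0 y v \<le> F1 v" for y v unfolding F1_def by (rule cSUP_upper[OF UNIV_I bdd])
  have F1_le: "F1 v \<le> a" if "\<And>y. f0 y v \<le> a" for v a unfolding F1_def by (rule cSUP_least) (use that in auto)
  have F1_nonneg: "0 \<le> F1 v" for v using order_trans[OF f0_nonneg F1_ge] .
  have F1_zero: "F1 v = 0" if "v \<notin> cbox (-B, -B) (B, B)" for v
    using F1_le[of v 0] F1_nonneg[of v] support_bound_momentum[OF B that] by simp
  have F1_meas [measurable]: "F1 \<in> borel_measurable borel"
    unfolding F1_def using continuous_f_v[of 0] f0_eq bdd by (intro borel_measurable_SUP_continuous) auto
  have F1_int: "integrable lborel F1"
  proof (rule Bochner_Integration.integrable_bound)
    show "integrable lborel (\<lambda>v. indicator (cbox (-B, -B) (B, B)) v * C :: real)"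
      using emeasure_lborel_cbox_finite by (intro integrable_mult_left) (auto simp: integrable_indicator_iff)
    show "AE v in lborel. norm (F1 v) \<le> norm (indicator (cbox (-B, -B) (B, B)) v * C)"
      using F1_nonneg F1_zero F1_le[OF f0_le] \<open>0 \<le> C\<close> by (auto simp: indicator_def)
  qed simp
  have F1_slice: "integrable lborel (\<lambda>w. F1 (w, u))" for u
  proof (rule Bochner_Integration.integrable_bound)
    show "integrable lborel (\<lambda>w. indicator {-B..B} w * C :: real)"
      using emeasure_lborel_cbox_finite[of "-B" B]
      by (intro integrable_mult_left) (auto simp: integrable_indicator_iff)
    have "norm (F1 (w, u)) \<le> norm (indicator {-B..B} w * C)" for w
      using F1_nonneg[of "(w, u)"] F1_zero[of "(w, u)"] F1_le[OF f0_le, of "(w, u)"] \<open>0 \<le> C\<close>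
      by (auto simp: indicator_def cbox_Pair_eq)
    then show "AE w in lborel. norm (F1 (w, u)) \<le> norm (indicator {-B..B} w * C)" by simp
  qed measurable
  obtain A where A: "support_bound (f t) A"
    using compactly_supported_bound[OF f_support[OF t]] by blast
  have f_int: "integrable lborel (f t x)"
    using continuous_f_v[OF t, of x] support_bound_momentum[OF A]
    by (intro integrable_continuous_compact_support[of "cbox (-A, -A) (A, A)"])
      (auto intro: continuous_on_subset)
  have f_slice: "integrable lborel (\<lambda>w. f t x (w, u))" for u
  proof (rule integrable_continuous_compact_support[of "{-A..A}"])
    show "continuous_on {-A..A} (\<lambda>w. f t x (w, u))"
      by (rule continuous_on_compose2[OF continuous_f_v[OF t]]) (auto intro!: continuous_intros)
    show "f t x (w, u) = 0" if "w \<notin> {-A..A}" for w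
      by (rule support_bound_momentum[OF A]) (use that in \<open>auto simp: cbox_Pair_eq\<close>)
  qed simp
  \<comment> \<open>Since the flow conserves the second momentum \<open>u\<close>, the passage from
    final to initial momentum maps each slice to itself and is expanding in the first component, so
    the one-dimensional substitution applies slice by slice.\<close>
  have slice: "(LINT w|lborel. f t x (w, u)) \<le> (LINT w|lborel. F1 (w, u))" for u
  proof -
    have "\<exists>D. ((\<lambda>w. fst (V 0 t x (w, u))) has_real_derivative D) (at w) \<and> 1 \<le> D" for w
      using V1_deriv_ge_1[of 0 t x u w] t by blast
    then obtain D where D: "\<And>w. ((\<lambda>w. fst (V 0 t x (w, u))) has_real_derivative D w) (at w)" "\<And>w. 1 \<le> D w"
      by metis
    have "f t x (w, u) \<le> F1 (fst (V 0 t x (w, u)), u)" for w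
    proof -
      have "V 0 t x (w, u) = (fst (V 0 t x (w, u)), u)"
        using V2[OF t order_refl, of x "(w, u)"] by (simp add: prod_eq_iff)
      then show ?thesis using f_eq_initial[OF t, of x "(w, u)"] F1_ge by metis
    qed
    from integral_expanding_substitution[OF D F1_slice F1_nonneg f_slice this] show ?thesis .
  qed
  have fubini: "integrable lborel (\<lambda>u. LINT w|lborel. g (w, u))"
    "(LINT u|lborel. LINT w|lborel. g (w, u)) = (LINT v|lborel. g v)"
    if "integrable lborel g" for g :: "real \<times> real \<Rightarrow> real"
    using lborel_pair.integrable_snd[of "curry g"] lborel_pair.integral_snd[of "curry g"] that
    by (simp_all add: lborel_prod)
  have "charge_density f t x = (LINT u|lborel. LINT w|lborel. f t x (w, u))"
    unfolding charge_density_def by (rule fubini(2)[OF f_int, symmetric])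
  also have "\<dots> \<le> (LINT u|lborel. LINT w|lborel. F1 (w, u))"
    by (intro integral_mono fubini(1) f_int F1_int slice)
  also have "\<dots> = (LINT v|lebesgue. F1 v)"
    by (simp add: fubini(2)[OF F1_int] integral_completion)
  \<comment> \<open>The comparison takes place in the completed measure, where \<open>F0\<close> is
    integrable.\<close>
  also have "\<dots> \<le> (LINT v|lebesgue. F0 v)"
  proof (rule integral_mono)
    show "integrable lebesgue F1" using F1_int by (simp add: integrable_completion)
  qed (use F0 F1_le in auto)
  finally show ?thesis .
qed

end

theorem theorem1p2:
  fixes f0 :: "real \<Rightarrow> real \<times> real \<Rightarrow> real"
    and f :: "real \<Rightarrow> real \<Rightarrow> real \<times> real \<Rightarrow> real"
    and X :: "real \<Rightarrow> real \<Rightarrow> real \<Rightarrow> real \<times> real \<Rightarrow> real"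
    and V :: "real \<Rightarrow> real \<Rightarrow> real \<Rightarrow> real \<times> real \<Rightarrow> real \<times> real"
    and F0 :: "real \<times> real \<Rightarrow> real"
  assumes "\<And>x v. f0 x v \<ge> 0"
    and "C1_on (\<lambda>(x, v). f0 x v) UNIV"
    and "compactly_supported (\<lambda>(x, v). f0 x v)"
    and "vlasov_poisson_solution f0 f"
    and "characteristics f X V"
    and "integrable lebesgue F0"
    and "\<And>x v. f0 x v \<le> F0 v"
  shows "(\<forall>s t x v1 v2. 0 \<le> s \<and> s \<le> t \<longrightarrow>
            (\<lambda>w. fst (V s t x (w, v2))) field_differentiable (at v1) \<and>
            1 \<le> deriv (\<lambda>w. fst (V s t x (w, v2))) v1)
       \<and> (\<forall>t x. 0 \<le> t \<longrightarrow> charge_density f t x \<le> (LINT v|lebesgue. F0 v))"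
proof -
  interpret vlasov_characteristics f0 f X V
    using assms(4,5) by unfold_locales
  show ?thesis
  proof (intro conjI allI impI)
    fix s t x v1 v2 :: real assume "0 \<le> s \<and> s \<le> t"
    then obtain D where D: "((\<lambda>w. fst (V s t x (w, v2))) has_real_derivative D) (at v1)" "1 \<le> D"
      using V1_deriv_ge_1 by blast
    then show "(\<lambda>w. fst (V s t x (w, v2))) field_differentiable (at v1)"
      by (auto simp: field_differentiable_def)
    show "1 \<le> deriv (\<lambda>w. fst (V s t x (w, v2))) v1"
      using D by (simp add: DERIV_imp_deriv)
  next
    fix t x :: real assume "0 \<le> t"
    then show "charge_density f t x \<le> (LINT v|lebesgue. F0 v)"
      using assms(6,7) by (rule charge_density_le)
  qed
qed

end
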